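(* For each $\zeta\in\mathbb{R}^3$, the operator $\hat B=L-i\,\frac{\zeta\cdot\mathbf q}{q^0}$ generates a strongly continuous contraction semigroup on $L^2(\mathbb{R}^3_{\mathbf q})$, and for every $f\in L^2(\mathbb{R}^3_{\mathbf q})$, $$\|\exp(t\hat B)f\|_{L^2(\mathbb{R}^3_{\mathbf q})}\le\|f\|_{L^2(\mathbb{R}^3_{\mathbf q})},\qquad t\ge0.$$
   Context: Dimensionless setting: $q^0=\sqrt{1+|\mathbf q|^2}$, $K_j(\beta)=\int_0^\infty\cosh(jr)e^{-\beta\cosh r}dr$, $M(\beta)=\int_{\mathbb{R}^3}e^{-\beta\sqrt{1+|\mathbf p|^2}}d\mathbf p$, $\Psi(\beta)=\frac3\beta+\frac{K_1(\beta)}{K_2(\beta)}$. Fix $\beta_0>0$, $J^0=e^{-\beta_0q^0}/M(\beta_0)$, $\alpha_0=K_1(\beta_0)/K_2(\beta_0)$, $\kappa_0=\frac{3\alpha_0}{\beta_0}+\alpha_0^2-1$. For $h=f\sqrt{J^0}$: $n_h\sqrt{1+|\mathbf u_h|^2}:=\int h\,d\mathbf q$, $n_h\alpha_h:=\int h\,d\mathbf q/q^0$, $n_h\mathbf u_h:=\int\mathbf q h\,d\mathbf q/q^0$; $P(f)=\big[\frac{\alpha_0q^0-1}{\kappa_0}n_h\sqrt{1+|\mathbf u_h|^2}+\frac{\Psi(\beta_0)-q^0}{\kappa_0}n_h\alpha_h+\beta_0n_h\mathbf u_h\cdot\mathbf q\big]\sqrt{J^0}$ and the linearized BGK operator is $Lf=\frac{P(f)-f}{q^0}$,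 acting on complex-valued $L^2(\mathbb{R}^3_{\mathbf q})$. *)

theory Defs
  imports "HOL-Analysis.Analysis"
begin

definition q0 :: "real^3 \<Rightarrow> real" where
  "q0 q = sqrt (1 + (norm q)^2)"

definition Kbes :: "real \<Rightarrow> real \<Rightarrow> real" where
  "Kbes j \<beta> = (LBINT r:{0..}. cosh (j * r) * exp (- \<beta> * cosh r))"

definition Mnorm :: "real \<Rightarrow> real" where
  "Mnorm \<beta> = (\<integral>p. exp (- \<beta> * q0 p) \<partial>lborel)"

definition Psi :: "real \<Rightarrow> real" where
  "Psi \<beta> = 3 / \<beta> + Kbes 1 \<beta> / Kbes 2 \<beta>"

definition J0 :: "real \<Rightarrow> real^3 \<Rightarrow> real" where
  "J0 \<beta>0 q = exp (- \<beta>0 * q0 q) / Mnorm \<beta>0"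

definition alpha0 :: "real \<Rightarrow> real" where
  "alpha0 \<beta>0 = Kbes 1 \<beta>0 / Kbes 2 \<beta>0"

definition kappa0 :: "real \<Rightarrow> real" where
  "kappa0 \<beta>0 = 3 * alpha0 \<beta>0 / \<beta>0 + (alpha0 \<beta>0)^2 - 1"

text \<open>The projection P(f); h = f sqrt(J0). The three moments are
  n_h sqrt(1+|u_h|^2) = int h, n_h alpha_h = int h/q0, n_h u_h = int q h / q0.\<close>
definition Pproj :: "real \<Rightarrow> (real^3 \<Rightarrow> complex) \<Rightarrow> real^3 \<Rightarrow> complex" where
  "Pproj \<beta>0 f q =
     (let h = (\<lambda>p. f p * complex_of_real (sqrt (J0 \<beta>0 p)));
          m0 = (\<integral>p. h p \<partial>lborel);
          m1 = (\<integral>p. h p / complex_of_real (q0 p) \<partial>lborel);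
          mu = (\<lambda>i. \<integral>p. complex_of_real (p $ i) * h p / complex_of_real (q0 p) \<partial>lborel)
      in ( complex_of_real ((alpha0 \<beta>0 * q0 q - 1) / kappa0 \<beta>0) * m0
         + complex_of_real ((Psi \<beta>0 - q0 q) / kappa0 \<beta>0) * m1
         + complex_of_real \<beta>0 * (\<Sum>i\<in>UNIV. mu i * complex_of_real (q $ i)) )
         * complex_of_real (sqrt (J0 \<beta>0 q)))"

definition Llin :: "real \<Rightarrow> (real^3 \<Rightarrow> complex) \<Rightarrow> real^3 \<Rightarrow> complex" where
  "Llin \<beta>0 f q = (Pproj \<beta>0 f q - f q) / complex_of_real (q0 q)"

definition Bhat :: "real \<Rightarrow> real^3 \<Rightarrow> (real^3 \<Rightarrow> complex) \<Rightarrow> real^3 \<Rightarrow> complex" where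
  "Bhat \<beta>0 \<zeta> f q = Llin \<beta>0 f q - \<i> * complex_of_real ((\<zeta> \<bullet> q) / q0 q) * f q"

text \<open>Complex L^2(R^3) represented by square-integrable measurable functions,
  with equality almost everywhere.\<close>
definition L2 :: "(real^3 \<Rightarrow> complex) set" where
  "L2 = {f. f \<in> borel_measurable lborel \<and> integrable lborel (\<lambda>q. (cmod (f q))^2)}"

definition L2norm :: "(real^3 \<Rightarrow> complex) \<Rightarrow> real" where
  "L2norm f = sqrt (\<integral>q. (cmod (f q))^2 \<partial>lborel)"

definition ae_eq :: "(real^3 \<Rightarrow> complex) \<Rightarrow> (real^3 \<Rightarrow> complex) \<Rightarrow> bool" where
  "ae_eq f g \<longleftrightarrow> (AE q in lborel. f q = g q)"

definition C0_semigroup :: "(real \<Rightarrow> (real^3 \<Rightarrow> complex) \<Rightarrow> real^3 \<Rightarrow> complex) \<Rightarrow> bool" where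
  "C0_semigroup T \<longleftrightarrow>
     (\<forall>t\<ge>0. \<forall>f\<in>L2. T t f \<in> L2) \<and>
     (\<forall>t\<ge>0. \<forall>f\<in>L2. \<forall>g\<in>L2. ae_eq f g \<longrightarrow> ae_eq (T t f) (T t g)) \<and>
     (\<forall>t\<ge>0. \<forall>f\<in>L2. \<forall>g\<in>L2. \<forall>a b::complex.
        ae_eq (T t (\<lambda>q. a * f q + b * g q)) (\<lambda>q. a * T t f q + b * T t g q)) \<and>
     (\<forall>t\<ge>0. \<exists>C. \<forall>f\<in>L2. L2norm (T t f) \<le> C * L2norm f) \<and>
     (\<forall>f\<in>L2. ae_eq (T 0 f) f) \<and>
     (\<forall>s\<ge>0. \<forall>t\<ge>0. \<forall>f\<in>L2. ae_eq (T (s + t) f) (T s (T t f))) \<and>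
     (\<forall>f\<in>L2. ((\<lambda>t. L2norm (\<lambda>q. T t f q - f q)) \<longlongrightarrow> 0) (at_right 0))"

definition contraction_semigroup :: "(real \<Rightarrow> (real^3 \<Rightarrow> complex) \<Rightarrow> real^3 \<Rightarrow> complex) \<Rightarrow> bool" where
  "contraction_semigroup T \<longleftrightarrow> C0_semigroup T \<and>
     (\<forall>t\<ge>0. \<forall>f\<in>L2. L2norm (T t f) \<le> L2norm f)"

definition has_generator ::
  "(real \<Rightarrow> (real^3 \<Rightarrow> complex) \<Rightarrow> real^3 \<Rightarrow> complex) \<Rightarrow> (real^3 \<Rightarrow> complex) set
    \<Rightarrow> ((real^3 \<Rightarrow> complex) \<Rightarrow> real^3 \<Rightarrow> complex) \<Rightarrow> bool" where
  "has_generator T D A \<longleftrightarrow> D \<subseteq> L2 \<and>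
     (\<forall>f\<in>L2. (f \<in> D \<longleftrightarrow> (\<exists>g\<in>L2.
         ((\<lambda>h. L2norm (\<lambda>q. (T h f q - f q) / complex_of_real h - g q)) \<longlongrightarrow> 0) (at_right 0)))) \<and>
     (\<forall>f\<in>D. A f \<in> L2 \<and>
         ((\<lambda>h. L2norm (\<lambda>q. (T h f q - f q) / complex_of_real h - A f q)) \<longlongrightarrow> 0) (at_right 0))"

end

theory Submission
  imports Defs
begin

text \<open>
  The operator is bounded on \<open>L\<^sup>2\<close>, so the semigroup is its exponential series. The projection
  \<open>P\<close> is orthogonal for the inner product with weight \<open>1 / q0\<close>: integration by parts identifies the
  Gram matrix of the invariants \<open>q0\<close>, \<open>1\<close>, \<open>q\<^sub>i\<close> with the Bessel function expressions in the
  coefficients of \<open>P\<close>. By Bessel's inequality \<open>Re \<langle>f, B f\<rangle> \<le> 0\<close>, the transport term being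
  skew-adjoint. For an arbitrary strongly continuous semigroup generated by \<open>B\<close>, uniform boundedness
  makes the orbits continuous, and a continuous function with nonpositive right derivative is
  nonincreasing; applied to \<open>\<parallel>T t f\<parallel>\<^sup>2\<close> this gives contractivity.
\<close>

section \<open>Square-integrable functions\<close>

text \<open>The theorem speaks of functions, not of equivalence classes, and its second half
  concerns every semigroup with the given generator. For such a semigroup the laws hold only almost
  everywhere and nothing relates it in advance to the exponential series, so contractivity has to
  come from the generator alone; the series then inherits it as an instance. The series can be
  summed at each point because of the shape of \<open>Bhat\<close>: multiplication by a bounded
  function plus an operator of finite rank whose range lies below a multiple of
  \<open>q0 * sqrt J0\<close>. The constants of the projection have a common origin.
  \<open>kappa0\<close> equals \<open>alpha0 * Psi - 1\<close>, the determinant of the Gram block of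
  energy and number, and \<open>\<beta>0\<close> is the reciprocal of the Gram entry of each
  momentum coordinate. The substitution \<open>norm p = sinh x\<close> brings momentum integrals and
  the kernels of \<open>Kbes\<close> into the same form, and integration by parts then links
  them.\<close>

lemma L2I: "f \<in> borel_measurable borel \<Longrightarrow> integrable lborel (\<lambda>q. (cmod (f q))\<^sup>2) \<Longrightarrow> f \<in> L2"
  by (simp add: L2_def)

lemma L2_measurable: "f \<in> L2 \<Longrightarrow> f \<in> borel_measurable borel"
  by (simp add: L2_def)

lemma L2_integrable: "f \<in> L2 \<Longrightarrow> integrable lborel (\<lambda>q. (cmod (f q))\<^sup>2)"
  by (simp add: L2_def)

lemma L2norm_nonneg [simp]: "0 \<le> L2norm f"
  by (simp add: L2norm_def)

lemma L2norm_power2: "(L2norm f)\<^sup>2 = (\<integral>q. (cmod (f q))\<^sup>2 \<partial>lborel)"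
  by (simp add: L2norm_def)

lemma L2norm_cong_AE:
  assumes "ae_eq f g" "f \<in> borel_measurable borel" "g \<in> borel_measurable borel"
  shows "L2norm f = L2norm g"
  using assms unfolding L2norm_def ae_eq_def
  by (intro arg_cong[where f=sqrt] integral_cong_AE) auto

lemma L2_dominated:
  assumes "f \<in> borel_measurable borel" "g \<in> L2" "\<And>q. cmod (f q) \<le> cmod (g q)"
  shows "f \<in> L2" "L2norm f \<le> L2norm g"
proof -
  have *: "(cmod (f q))\<^sup>2 \<le> (cmod (g q))\<^sup>2" for q
    using assms(3)[of q] by (intro power_mono) auto
  show "f \<in> L2"
    using assms(1) * by (intro L2I Bochner_Integration.integrable_bound[OF L2_integrable[OF assms(2)]]) auto
  then show "L2norm f \<le> L2norm g"
    unfolding L2norm_def using * assms(2)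
    by (intro real_sqrt_le_mono integral_mono L2_integrable)
qed

lemma L2_mult:
  assumes "f \<in> L2"
  shows "(\<lambda>q. a * f q) \<in> L2" "L2norm (\<lambda>q. a * f q) = cmod a * L2norm f"
proof -
  show "(\<lambda>q. a * f q) \<in> L2"
    using L2_measurable[OF assms] L2_integrable[OF assms]
    by (intro L2I) (simp_all add: norm_mult power_mult_distrib)
  show "L2norm (\<lambda>q. a * f q) = cmod a * L2norm f"
    by (simp add: L2norm_def norm_mult power_mult_distrib real_sqrt_mult)
qed

lemma L2_zero: "(\<lambda>q. 0) \<in> L2" "L2norm (\<lambda>q. 0) = 0"
  by (auto intro: L2I simp: L2norm_def)

lemma L2_cmod:
  assumes "f \<in> L2"
  shows "(\<lambda>q. complex_of_real (cmod (f q))) \<in> L2" "L2norm (\<lambda>q. complex_of_real (cmod (f q))) = L2norm f"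
  using L2_measurable[OF assms] L2_integrable[OF assms] by (auto intro!: L2I simp: L2norm_def)

lemma L2_add:
  assumes "f \<in> L2" "g \<in> L2"
  shows "(\<lambda>q. f q + g q) \<in> L2"
proof (rule L2I)
  have "(cmod (f q + g q))\<^sup>2 \<le> 2 * ((cmod (f q))\<^sup>2 + (cmod (g q))\<^sup>2)" for q
  proof -
    have "(cmod (f q + g q))\<^sup>2 \<le> (cmod (f q) + cmod (g q))\<^sup>2"
      by (intro power_mono norm_triangle_ineq) auto
    also have "\<dots> \<le> 2 * ((cmod (f q))\<^sup>2 + (cmod (g q))\<^sup>2)"
      using sum_squares_bound[of "cmod (f q)" "cmod (g q)"] by (simp add: power2_sum)
    finally show ?thesis .
  qed
  moreover have "integrable lborel (\<lambda>q. 2 * ((cmod (f q))\<^sup>2 + (cmod (g q))\<^sup>2))"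
    using assms[THEN L2_integrable] by simp
  ultimately show "integrable lborel (\<lambda>q. (cmod (f q + g q))\<^sup>2)"
    using assms[THEN L2_measurable] by (elim Bochner_Integration.integrable_bound) auto
qed (use assms[THEN L2_measurable] in simp)

lemma L2_lincomb: "f \<in> L2 \<Longrightarrow> g \<in> L2 \<Longrightarrow> (\<lambda>q. a * f q + b * g q) \<in> L2"
  by (intro L2_add L2_mult)

lemma L2_diff: "f \<in> L2 \<Longrightarrow> g \<in> L2 \<Longrightarrow> (\<lambda>q. f q - g q) \<in> L2"
  using L2_lincomb[of f g 1 "-1"] by simp

lemma L2_sum: "finite I \<Longrightarrow> (\<And>i. i \<in> I \<Longrightarrow> f i \<in> L2) \<Longrightarrow> (\<lambda>q. \<Sum>i\<in>I. f i q) \<in> L2"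
  by (induction I rule: finite_induct) (auto intro: L2_add L2_zero)

text \<open>Integrate a weighted arithmetic-geometric mean inequality and optimise the weight; a
  vanishing seminorm is treated separately because no optimal positive weight exists then. Moduli on
  the left make the bound usable for real inner products and for complex moments alike.\<close>

lemma L2_Cauchy_Schwarz:
  assumes f: "f \<in> L2" and g: "g \<in> L2"
  shows "integrable lborel (\<lambda>q. cmod (f q) * cmod (g q))" (is ?A)
    and "(\<integral>q. cmod (f q) * cmod (g q) \<partial>lborel) \<le> L2norm f * L2norm g" (is ?B)
proof -
  note [measurable] = L2_measurable[OF f] L2_measurable[OF g]
  have int: "integrable lborel (\<lambda>q. (cmod (f q))\<^sup>2)" "integrable lborel (\<lambda>q. (cmod (g q))\<^sup>2)"
    by (rule L2_integrable[OF f], rule L2_integrable[OF g])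
  have amgm: "cmod (f q) * cmod (g q) \<le> (s * (cmod (f q))\<^sup>2 + (cmod (g q))\<^sup>2 / s) / 2"
    if "s > 0" for s q
  proof -
    have "0 \<le> (s * cmod (f q) - cmod (g q))\<^sup>2 / s" using that by simp
    also have "\<dots> = s * (cmod (f q))\<^sup>2 + (cmod (g q))\<^sup>2 / s - 2 * (cmod (f q) * cmod (g q))"
      using that by (simp add: field_simps power2_eq_square)
    finally show ?thesis by simp
  qed
  show A: ?A
  proof (rule Bochner_Integration.integrable_bound)
    show "integrable lborel (\<lambda>q. ((cmod (f q))\<^sup>2 + (cmod (g q))\<^sup>2) / 2)"
      using int by simp
    show "AE q in lborel. norm (cmod (f q) * cmod (g q)) \<le> norm (((cmod (f q))\<^sup>2 + (cmod (g q))\<^sup>2) / 2)"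
      using amgm[of 1] by (intro AE_I2) simp
  qed measurable
  have le: "(\<integral>q. cmod (f q) * cmod (g q) \<partial>lborel) \<le> (s * (L2norm f)\<^sup>2 + (L2norm g)\<^sup>2 / s) / 2" if "s > 0" for s
  proof -
    have "(\<integral>q. cmod (f q) * cmod (g q) \<partial>lborel) \<le> (\<integral>q. (s * (cmod (f q))\<^sup>2 + (cmod (g q))\<^sup>2 / s) / 2 \<partial>lborel)"
      using amgm[OF that] A int by (intro integral_mono) auto
    also have "\<dots> = (s * (L2norm f)\<^sup>2 + (L2norm g)\<^sup>2 / s) / 2"
      using int by (simp add: L2norm_power2)
    finally show ?thesis .
  qed
  have zero: "(\<integral>q. cmod (f q) * cmod (g q) \<partial>lborel) = 0" if "(\<integral>q. (cmod (f q))\<^sup>2 \<partial>lborel) = 0 \<or> (\<integral>q. (cmod (g q))\<^sup>2 \<partial>lborel) = 0"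
  proof (rule integral_eq_zero_AE)
    from that consider "AE q in lborel. f q = 0" | "AE q in lborel. g q = 0"
      using integral_nonneg_eq_0_iff_AE[OF int(1)] integral_nonneg_eq_0_iff_AE[OF int(2)] by force
    then show "AE q in lborel. cmod (f q) * cmod (g q) = 0"
    proof cases
      case 1 then show ?thesis by eventually_elim simp
    next
      case 2 then show ?thesis by eventually_elim simp
    qed
  qed
  show ?B
  proof (cases "L2norm f = 0 \<or> L2norm g = 0")
    case True
    then have "(L2norm f)\<^sup>2 = 0 \<or> (L2norm g)\<^sup>2 = 0" by auto
    then show ?thesis using zero True unfolding L2norm_power2 by auto
  next
    case False
    then have "L2norm f > 0" "L2norm g > 0" using L2norm_nonneg[of f] L2norm_nonneg[of g] by linarith+
    \<comment> \<open>The weight \<open>L2norm g / L2norm f\<close> makes the two terms on the right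
      of \<open>le\<close> equal.\<close>
    then show ?thesis
      using le[of "L2norm g / L2norm f"] by (simp add: field_simps power2_eq_square)
  qed
qed

lemma L2_triangle:
  assumes f: "f \<in> L2" and g: "g \<in> L2"
  shows "L2norm (\<lambda>q. f q + g q) \<le> L2norm f + L2norm g"
proof (rule power2_le_imp_le)
  note int = L2_integrable[OF f] L2_integrable[OF g] L2_Cauchy_Schwarz(1)[OF f g]
  have "(L2norm (\<lambda>q. f q + g q))\<^sup>2 \<le> (\<integral>q. (cmod (f q))\<^sup>2 + (cmod (g q))\<^sup>2 + 2 * (cmod (f q) * cmod (g q)) \<partial>lborel)"
    unfolding L2norm_power2
  proof (rule integral_mono)
    show "integrable lborel (\<lambda>q. (cmod (f q + g q))\<^sup>2)"
      using L2_integrable[OF L2_add[OF f g]] .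
    show "(cmod (f q + g q))\<^sup>2 \<le> (cmod (f q))\<^sup>2 + (cmod (g q))\<^sup>2 + 2 * (cmod (f q) * cmod (g q))" for q
      using power_mono[OF norm_triangle_ineq[of "f q" "g q"], of 2] by (simp add: power2_sum)
  qed (use int in auto)
  also have "\<dots> = (L2norm f)\<^sup>2 + (L2norm g)\<^sup>2 + 2 * (\<integral>q. cmod (f q) * cmod (g q) \<partial>lborel)"
    using int by (simp add: L2norm_power2)
  also have "\<dots> \<le> (L2norm f + L2norm g)\<^sup>2"
    using L2_Cauchy_Schwarz(2)[OF f g] by (simp add: power2_sum)
  finally show "(L2norm (\<lambda>q. f q + g q))\<^sup>2 \<le> (L2norm f + L2norm g)\<^sup>2" .
qed simp

lemma L2_triangle_rev:
  assumes "f \<in> L2" "g \<in> L2"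
  shows "\<bar>L2norm f - L2norm g\<bar> \<le> L2norm (\<lambda>q. f q - g q)"
proof -
  have "L2norm (\<lambda>q. g q - f q) = L2norm (\<lambda>q. f q - g q)"
    by (simp add: L2norm_def norm_minus_commute)
  then show ?thesis
    using L2_triangle[OF L2_diff[OF assms] assms(2)] L2_triangle[OF L2_diff[OF assms(2,1)] assms(1)] by auto
qed

section \<open>Completeness and uniform boundedness in \<open>L2\<close>\<close>

text \<open>With \<open>d k q = x (Suc k) q - x k q\<close>, the weighted sum \<open>\<Sum>k. 2 ^ k * (cmod (d k q))\<^sup>2\<close> is
  integrable, so \<open>\<Sum>k. d k q\<close> converges almost everywhere.\<close>

lemma L2_complete:
  assumes x: "\<And>k. x k \<in> L2" and d: "\<And>k. L2norm (\<lambda>q. x (Suc k) q - x k q) \<le> (1/2) ^ k"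
  obtains y where "y \<in> L2" "(\<lambda>k. L2norm (\<lambda>q. y q - x k q)) \<longlonglongrightarrow> 0"
proof -
  note [measurable] = L2_measurable[OF x]
  define D where "D k q = (cmod (x (Suc k) q - x k q))\<^sup>2" for k q
  have Dint: "integrable lborel (D k)" for k
    unfolding D_def by (intro L2_integrable L2_diff x)
  have Dle: "(\<integral>q. D k q \<partial>lborel) \<le> (1/4) ^ k" for k
  proof -
    have "(\<integral>q. D k q \<partial>lborel) = (L2norm (\<lambda>q. x (Suc k) q - x k q))\<^sup>2"
      by (simp add: D_def L2norm_power2)
    also have "\<dots> \<le> ((1/2) ^ k)\<^sup>2" using d by (intro power_mono) auto
    also have "\<dots> = (1/4) ^ k" by (simp add: power2_eq_square flip: power_mult_distrib)
    finally show ?thesis .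
  qed
  define W where "W k q = 2 ^ k * D k q" for k q
  have Wint: "integrable lborel (W k)" for k unfolding W_def using Dint by simp
  have W0: "0 \<le> W k q" for k q by (simp add: W_def D_def)
  have Wle: "(\<integral>q. W k q \<partial>lborel) \<le> (1/2) ^ k" for k
  proof -
    have "(\<integral>q. W k q \<partial>lborel) = 2 ^ k * (\<integral>q. D k q \<partial>lborel)" by (simp add: W_def)
    also have "\<dots> \<le> 2 ^ k * (1/4) ^ k" using Dle by (intro mult_left_mono) auto
    also have "\<dots> = (1/2) ^ k" by (simp flip: power_mult_distrib)
    finally show ?thesis .
  qed
  have "AE q in lborel. \<exists>y. (\<lambda>k. x k q) \<longlonglongrightarrow> y"
  proof -
    have nn: "(\<integral>\<^sup>+q. ennreal (W k q) \<partial>lborel) \<le> ennreal ((1/2) ^ k)" for k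
      using Wle[of k] by (subst nn_integral_eq_integral[OF Wint]) (auto simp: W0 intro: ennreal_leI)
    have "(\<integral>\<^sup>+q. (\<Sum>k. ennreal (W k q)) \<partial>lborel) = (\<Sum>k. \<integral>\<^sup>+q. ennreal (W k q) \<partial>lborel)"
      using Wint by (intro nn_integral_suminf) (auto simp: W_def D_def)
    also have "\<dots> \<le> (\<Sum>k. ennreal ((1/2) ^ k))" by (intro suminf_le nn) auto
    also have "\<dots> < \<infinity>"
      by (subst suminf_ennreal2) (auto simp: summable_geometric)
    finally have "AE q in lborel. (\<Sum>k. ennreal (W k q)) \<noteq> \<infinity>"
      by (intro nn_integral_PInf_AE) (auto simp: W_def D_def)
    then show ?thesis
    proof eventually_elim
      case (elim q)
      then have sW: "summable (\<lambda>k. W k q)" using W0 by (intro summable_suminf_not_top) auto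
      have "summable (\<lambda>k. x (Suc k) q - x k q)"
      proof (rule summable_comparison_test)
        show "summable (\<lambda>k. (W k q + (1/2) ^ k) / 2)"
          using sW by (intro summable_divide summable_add) (auto simp: summable_geometric)
        have "norm (x (Suc k) q - x k q) \<le> (W k q + (1/2) ^ k) / 2" for k
        proof -
          \<comment> \<open>Weighted mean inequality: \<open>n\<close> is at most half the sum of
            \<open>2 ^ k * n\<^sup>2\<close>, summable at this point, and
            \<open>(1/2) ^ k\<close>.\<close>
          define n where "n = norm (x (Suc k) q - x k q)"
          have "0 \<le> (2 ^ k * n - 1)\<^sup>2 * (1/2) ^ k" by simp
          also have "\<dots> = 2 ^ k * n\<^sup>2 + (1/2) ^ k - 2 * n"
            by (simp add: power2_eq_square field_simps power_one_over)
          finally show ?thesis unfolding W_def D_def n_def[symmetric] by simp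
        qed
        then show "\<exists>N. \<forall>k\<ge>N. norm (x (Suc k) q - x k q) \<le> (W k q + (1/2) ^ k) / 2" by blast
      qed
      then have "(\<lambda>n. \<Sum>k<n. x (Suc k) q - x k q) \<longlonglongrightarrow> (\<Sum>k. x (Suc k) q - x k q)"
        by (rule summable_LIMSEQ)
      from tendsto_add[OF this tendsto_const[of "x 0 q"]]
      have "(\<lambda>n. x n q) \<longlonglongrightarrow> (\<Sum>k. x (Suc k) q - x k q) + x 0 q"
        by (simp add: sum_lessThan_telescope[of "\<lambda>k. x k q"])
      then show ?case by blast
    qed
  qed
  then have conv: "AE q in lborel. convergent (\<lambda>k. x k q)" by (simp add: convergent_def)
  \<comment> \<open>\<open>lim\<close> has some value also where the sequence diverges; those points
    form a null set, and \<open>y\<close> is measurable on the whole space.\<close>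
  define y where "y q = lim (\<lambda>k. x k q)" for q
  have ym [measurable]: "y \<in> borel_measurable borel" unfolding y_def by measurable
  have ylim: "AE q in lborel. (\<lambda>k. x k q) \<longlonglongrightarrow> y q"
    using conv by eventually_elim (simp add: y_def convergent_LIMSEQ_iff)
  \<comment> \<open>The subtracted term carries the induction: halving it frees exactly the next
    increment \<open>(1/2) ^ (k + j)\<close>.\<close>
  have dist: "L2norm (\<lambda>q. x (k + j) q - x k q) \<le> 2 * (1/2) ^ k - 2 * (1/2) ^ (k + j)" for k j
  proof (induction j)
    case 0 then show ?case by (simp add: L2_zero)
  next
    case (Suc j)
    have "L2norm (\<lambda>q. x (k + Suc j) q - x k q) =
        L2norm (\<lambda>q. (x (Suc (k + j)) q - x (k + j) q) + (x (k + j) q - x k q))" by simp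
    also have "\<dots> \<le> L2norm (\<lambda>q. x (Suc (k + j)) q - x (k + j) q) + L2norm (\<lambda>q. x (k + j) q - x k q)"
      by (intro L2_triangle L2_diff x)
    also have "\<dots> \<le> (1/2) ^ (k + j) + (2 * (1/2) ^ k - 2 * (1/2) ^ (k + j))"
      by (intro add_mono d Suc)
    finally show ?case by simp
  qed
  \<comment> \<open>Fatou's lemma in \<open>j\<close> carries the bound on \<open>x j - x k\<close>
    to the limit. The integrals are taken in \<open>ennreal\<close> because square integrability of
    \<open>y - x k\<close> is only deduced from this bound.\<close>
  have nnk: "(\<integral>\<^sup>+q. ennreal ((cmod (y q - x k q))\<^sup>2) \<partial>lborel) \<le> ennreal (4 * (1/4) ^ k)" for k
  proof -
    have "(\<integral>\<^sup>+q. ennreal ((cmod (y q - x k q))\<^sup>2) \<partial>lborel) =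
        (\<integral>\<^sup>+q. liminf (\<lambda>j. ennreal ((cmod (x j q - x k q))\<^sup>2)) \<partial>lborel)"
    proof (rule nn_integral_cong_AE, use ylim in eventually_elim)
      case (elim q)
      have "(\<lambda>j. ennreal ((cmod (x j q - x k q))\<^sup>2)) \<longlonglongrightarrow> ennreal ((cmod (y q - x k q))\<^sup>2)"
        by (intro tendsto_intros tendsto_ennrealI elim)
      from lim_imp_Liminf[OF _ this] show ?case by simp
    qed
    also have "\<dots> \<le> liminf (\<lambda>j. \<integral>\<^sup>+q. ennreal ((cmod (x j q - x k q))\<^sup>2) \<partial>lborel)"
      by (intro nn_integral_liminf) auto
    also have "\<dots> \<le> liminf (\<lambda>j::nat. ennreal (4 * (1/4) ^ k))"
    proof (rule Liminf_mono, use eventually_ge_at_top[of k] in eventually_elim)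
      case (elim j)
      have "(\<integral>\<^sup>+q. ennreal ((cmod (x j q - x k q))\<^sup>2) \<partial>lborel) = ennreal ((L2norm (\<lambda>q. x j q - x k q))\<^sup>2)"
        unfolding L2norm_power2 by (intro nn_integral_eq_integral L2_integrable L2_diff x) auto
      also have "\<dots> \<le> ennreal ((2 * (1/2) ^ k)\<^sup>2)"
      proof (intro ennreal_leI power_mono)
        have "L2norm (\<lambda>q. x j q - x k q) \<le> 2 * (1/2) ^ k - 2 * (1/2) ^ j"
          using dist[of k "j - k"] elim by simp
        also have "\<dots> \<le> 2 * (1/2) ^ k" by simp
        finally show "L2norm (\<lambda>q. x j q - x k q) \<le> 2 * (1/2) ^ k" .
      qed simp
      also have "(2 * (1/2::real) ^ k)\<^sup>2 = 4 * (1/4) ^ k"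
        by (simp add: power2_eq_square flip: power_mult_distrib)
      finally show ?case .
    qed
    also have "\<dots> = ennreal (4 * (1/4) ^ k)" by (simp add: Liminf_const)
    finally show ?thesis .
  qed
  have diffL2: "(\<lambda>q. y q - x k q) \<in> L2" for k
  proof (rule L2I)
    show "integrable lborel (\<lambda>q. (cmod (y q - x k q))\<^sup>2)"
      using nnk[of k] by (intro integrableI_bounded) (auto simp: le_less_trans)
  qed measurable
  have normk: "L2norm (\<lambda>q. y q - x k q) \<le> 2 * (1/2) ^ k" for k
  proof (rule power2_le_imp_le)
    have "ennreal ((L2norm (\<lambda>q. y q - x k q))\<^sup>2) = (\<integral>\<^sup>+q. ennreal ((cmod (y q - x k q))\<^sup>2) \<partial>lborel)"
      unfolding L2norm_power2 by (intro nn_integral_eq_integral[symmetric] L2_integrable diffL2) auto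
    also note nnk[of k]
    finally have "(L2norm (\<lambda>q. y q - x k q))\<^sup>2 \<le> 4 * (1/4) ^ k" by (simp add: ennreal_le_iff)
    also have "\<dots> = (2 * (1/2) ^ k)\<^sup>2"
      by (simp add: power2_eq_square flip: power_mult_distrib)
    finally show "(L2norm (\<lambda>q. y q - x k q))\<^sup>2 \<le> (2 * (1/2) ^ k)\<^sup>2" .
  qed simp
  show thesis
  proof
    have "(\<lambda>q. (y q - x 0 q) + x 0 q) \<in> L2" by (intro L2_add diffL2 x)
    then show "y \<in> L2" by simp
    have "(\<lambda>k. 2 * (1/2::real) ^ k) \<longlonglongrightarrow> 2 * 0" by (intro tendsto_intros) auto
    then have lim: "(\<lambda>k. 2 * (1/2::real) ^ k) \<longlonglongrightarrow> 0" by simp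
    show "(\<lambda>k. L2norm (\<lambda>q. y q - x k q)) \<longlonglongrightarrow> 0"
      by (rule tendsto_sandwich[OF _ _ tendsto_const lim]) (simp_all add: normk)
  qed
qed

text \<open>\<open>L2\<close> is a set of functions with a seminorm rather than a complete metric space type, so the
  Baire argument is carried out by hand with nested balls.\<close>

lemma L2_uniform_boundedness:
  fixes p :: "nat \<Rightarrow> (real^3 \<Rightarrow> complex) \<Rightarrow> real"
  assumes tri: "\<And>n f g. f \<in> L2 \<Longrightarrow> g \<in> L2 \<Longrightarrow> p n (\<lambda>q. f q + g q) \<le> p n f + p n g"
    and hom: "\<And>n f c. f \<in> L2 \<Longrightarrow> p n (\<lambda>q. complex_of_real c * f q) = \<bar>c\<bar> * p n f"
    and bdd: "\<And>n. \<exists>C. \<forall>f\<in>L2. p n f \<le> C * L2norm f"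
    and pointwise: "\<And>f. f \<in> L2 \<Longrightarrow> \<exists>K. \<forall>n. p n f \<le> K"
  shows "\<exists>K. \<forall>n. \<forall>f\<in>L2. p n f \<le> K * L2norm f"
proof (rule ccontr)
  assume "\<not> ?thesis"
  then have unb: "\<exists>n. \<exists>f\<in>L2. K * L2norm f < p n f" for K
    by (meson not_le)
  \<comment> \<open>Every ball contains points with large \<open>p n y\<close>: move from the centre
    in a direction where \<open>p n\<close> is large. Since \<open>p n x\<close> is bounded over
    \<open>n\<close>, subadditivity prevents the centre from cancelling the gain.\<close>
  have large: "\<exists>n. \<exists>y\<in>L2. L2norm (\<lambda>q. y q - x q) \<le> r \<and> K < p n y" if x: "x \<in> L2" and r: "r > 0" for x r K
  proof -
    obtain K0 where K0: "p n x \<le> K0" for n using pointwise[OF x] by blast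
    \<comment> \<open>Once \<open>f\<close> is scaled to norm \<open>r\<close>, its
      \<open>p n\<close> exceeds \<open>K + K0\<close>, where \<open>K0\<close> is the share that
      the centre may take away.\<close>
    obtain n f where f: "f \<in> L2" and nf: "(K + K0) / r * L2norm f < p n f" using unb by blast
    have "L2norm f \<noteq> 0"
    proof
      assume 0: "L2norm f = 0"
      then have "p n f \<le> 0" using bdd[of n] f by fastforce
      then show False using nf 0 by simp
    qed
    then have pos: "L2norm f > 0" using L2norm_nonneg[of f] by linarith
    define c where "c = r / L2norm f"
    define y where "y q = x q + complex_of_real c * f q" for q
    have c: "c > 0" using pos r by (simp add: c_def)
    have y: "y \<in> L2" unfolding y_def by (intro L2_add L2_mult x f)
    have nx: "p n (\<lambda>q. complex_of_real (-1) * x q) = p n x" using hom[OF x, of n "-1"] by simp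
    have "L2norm (\<lambda>q. y q - x q) = r"
    proof -
      have "L2norm (\<lambda>q. y q - x q) = \<bar>c\<bar> * L2norm f"
        using L2_mult(2)[OF f, of "complex_of_real c"] by (simp add: y_def)
      then show ?thesis using c pos r by (simp add: c_def)
    qed
    moreover have "c * p n f \<le> p n y + p n x"
    proof -
      have "c * p n f = p n (\<lambda>q. complex_of_real c * f q)" using hom[OF f, of n c] c by simp
      also have "(\<lambda>q. complex_of_real c * f q) = (\<lambda>q. y q + complex_of_real (-1) * x q)"
        by (simp add: y_def)
      also have "p n \<dots> \<le> p n y + p n x"
        using tri[OF y L2_mult(1)[OF x], of n "complex_of_real (-1)"] unfolding nx .
      finally show ?thesis .
    qed
    moreover have "K + K0 < c * p n f"
      using nf pos r by (simp add: c_def field_simps)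
    ultimately show ?thesis using y K0[of n] by (intro exI[of _ n] bexI[of _ y]) auto
  qed
  \<comment> \<open>\<open>fst\<close> is the centre and \<open>snd\<close> the radius of a ball.
    The lower bound is demanded on the whole closed ball, so that it still holds at the limit of the
    centres.\<close>
  define Q where "Q k xr ys \<longleftrightarrow>
      L2norm (\<lambda>q. fst ys q - fst xr q) \<le> snd xr / 2 \<and> snd ys \<le> snd xr / 2 \<and>
      (\<exists>n. \<forall>z\<in>L2. L2norm (\<lambda>q. z q - fst ys q) \<le> snd ys \<longrightarrow> real k < p n z)"
    for k and xr ys :: "(real^3 \<Rightarrow> complex) \<times> real"
  have ball: "\<exists>ys. (fst ys \<in> L2 \<and> snd ys > 0) \<and> Q k xr ys" if xr: "fst xr \<in> L2 \<and> snd xr > 0" for xr k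
  proof -
    obtain n y where y: "y \<in> L2" "L2norm (\<lambda>q. y q - fst xr q) \<le> snd xr / 2" "real k + 1 < p n y"
      using large[of "fst xr" "snd xr / 2" "real k + 1"] xr by auto
    obtain C where C: "\<And>f. f \<in> L2 \<Longrightarrow> p n f \<le> C * L2norm f" using bdd by blast
    \<comment> \<open>The first bound keeps the new ball inside the old one; the second limits the
      drop of \<open>p n\<close> on it to 1, the margin reserved by
      \<open>real k + 1\<close>.\<close>
    define s where "s = min (snd xr / 2) (1 / (\<bar>C\<bar> + 1))"
    have s: "s > 0" "s \<le> snd xr / 2" "s \<le> 1 / (\<bar>C\<bar> + 1)" using xr by (auto simp: s_def)
    have "real k < p n z" if z: "z \<in> L2" and zy: "L2norm (\<lambda>q. z q - y q) \<le> s" for z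
    proof -
      have "L2norm (\<lambda>q. y q - z q) = L2norm (\<lambda>q. z q - y q)"
        by (simp add: L2norm_def norm_minus_commute)
      then have "p n (\<lambda>q. y q - z q) \<le> C * L2norm (\<lambda>q. z q - y q)"
        using C[OF L2_diff[OF y(1) z]] by simp
      also have "\<dots> \<le> (\<bar>C\<bar> + 1) * s"
        using zy by (intro mult_mono) auto
      also have "\<dots> \<le> 1" using s(3) by (simp add: field_simps)
      finally have "p n (\<lambda>q. y q - z q) \<le> 1" .
      moreover have "p n y \<le> p n (\<lambda>q. y q - z q) + p n z"
        using tri[OF L2_diff[OF y(1) z] z, of n] by simp
      ultimately show ?thesis using y(3) by linarith
    qed
    then show ?thesis unfolding Q_def using y s by (intro exI[of _ "(y, s)"]) auto
  qed
  have "\<exists>u. (\<forall>k. fst (u k) \<in> L2 \<and> snd (u k) > 0) \<and> (\<forall>k. Q k (u k) (u (Suc k)))"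
    using dependent_nat_choice[where P="\<lambda>_ x. fst x \<in> L2 \<and> snd x > 0" and Q=Q] ball L2_zero(1)
    by (metis fst_conv snd_conv zero_less_one)
  then obtain u where u: "\<And>k. fst (u k) \<in> L2" "\<And>k. snd (u k) > 0" "\<And>k. Q k (u k) (u (Suc k))"
    by blast
  \<comment> \<open>Division by the initial radius normalises the increments of the centres to
    \<open>(1/2) ^ k\<close>, the rate that \<open>L2_complete\<close> asks for.\<close>
  define v where "v k q = fst (u k) q / complex_of_real (snd (u 0))" for k q
  have step: "L2norm (\<lambda>q. fst (u (Suc k)) q - fst (u k) q) \<le> snd (u k) / 2"
    "snd (u (Suc k)) \<le> snd (u k) / 2" for k
    using u(3)[of k] unfolding Q_def by auto
  have rk: "snd (u k) \<le> snd (u 0) * (1/2) ^ k" for k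
  proof (induction k)
    case (Suc k) then show ?case using step(2)[of k] by simp
  qed simp
  have "v k \<in> L2" for k
    unfolding v_def using L2_mult(1)[OF u(1)[of k], of "1 / complex_of_real (snd (u 0))"] by simp
  moreover have "L2norm (\<lambda>q. v (Suc k) q - v k q) \<le> (1/2) ^ k" for k
  proof -
    have "L2norm (\<lambda>q. v (Suc k) q - v k q) =
      L2norm (\<lambda>q. complex_of_real (1 / snd (u 0)) * (fst (u (Suc k)) q - fst (u k) q))"
      by (simp add: v_def diff_divide_distrib)
    also have "\<dots> = L2norm (\<lambda>q. fst (u (Suc k)) q - fst (u k) q) / snd (u 0)"
      using u(2)[of 0] by (subst L2_mult(2)[OF L2_diff[OF u(1) u(1)]]) (simp add: norm_divide)
    also have "\<dots> \<le> (1/2) ^ k"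
      using step(1)[of k] rk[of k] u(2)[of 0] u(2)[of k] by (simp add: divide_le_eq mult.commute)
    finally show ?thesis .
  qed
  ultimately obtain y where y: "y \<in> L2" "(\<lambda>k. L2norm (\<lambda>q. y q - v k q)) \<longlonglongrightarrow> 0"
    using L2_complete[of v] by blast
  define z where "z q = complex_of_real (snd (u 0)) * y q" for q
  have z: "z \<in> L2" unfolding z_def by (intro L2_mult y)
  have "L2norm (\<lambda>q. z q - fst (u k) q) = snd (u 0) * L2norm (\<lambda>q. y q - v k q)" for k
  proof -
    have "(\<lambda>q. z q - fst (u k) q) = (\<lambda>q. complex_of_real (snd (u 0)) * (y q - v k q))"
      using u(2)[of 0] by (auto simp: z_def v_def field_simps)
    then show ?thesis
      using L2_mult(2)[OF L2_diff[OF y(1) \<open>v k \<in> L2\<close>], of "complex_of_real (snd (u 0))"] u(2)[of 0] by simp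
  qed
  then have zlim: "(\<lambda>k. L2norm (\<lambda>q. z q - fst (u k) q)) \<longlonglongrightarrow> 0"
    using tendsto_mult_left[OF y(2), of "snd (u 0)"] by simp
  \<comment> \<open>A centre moves by at most the loss of radius in the same step, so the distances
    telescope and the balls are nested.\<close>
  have dist: "L2norm (\<lambda>q. fst (u (k + j)) q - fst (u k) q) \<le> snd (u k) - snd (u (k + j))" for k j
  proof (induction j)
    case 0 then show ?case by (simp add: L2_zero)
  next
    case (Suc j)
    have "L2norm (\<lambda>q. fst (u (k + Suc j)) q - fst (u k) q) =
        L2norm (\<lambda>q. (fst (u (Suc (k + j))) q - fst (u (k + j)) q) + (fst (u (k + j)) q - fst (u k) q))" by simp
    also have "\<dots> \<le> L2norm (\<lambda>q. fst (u (Suc (k + j))) q - fst (u (k + j)) q) + L2norm (\<lambda>q. fst (u (k + j)) q - fst (u k) q)"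
      by (intro L2_triangle L2_diff u)
    also have "\<dots> \<le> snd (u k) - snd (u (k + Suc j))"
      using Suc step[of "k + j"] by simp
    finally show ?case .
  qed
  have inball: "L2norm (\<lambda>q. z q - fst (u k) q) \<le> snd (u k)" for k
  proof (rule field_le_epsilon)
    fix e :: real assume "e > 0"
    then have "\<forall>\<^sub>F j in sequentially. L2norm (\<lambda>q. z q - fst (u j) q) < e"
      using zlim by (simp add: order_tendstoD)
    then obtain N where N: "\<And>j. j \<ge> N \<Longrightarrow> L2norm (\<lambda>q. z q - fst (u j) q) < e"
      by (auto simp: eventually_sequentially)
    have "L2norm (\<lambda>q. z q - fst (u k) q) =
        L2norm (\<lambda>q. (z q - fst (u (k + N)) q) + (fst (u (k + N)) q - fst (u k) q))" by simp
    also have "\<dots> \<le> L2norm (\<lambda>q. z q - fst (u (k + N)) q) + L2norm (\<lambda>q. fst (u (k + N)) q - fst (u k) q)"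
      by (intro L2_triangle L2_diff u z)
    also have "\<dots> \<le> e + snd (u k)"
      using N[of "k + N"] dist[of k N] u(2)[of "k + N"] by simp
    finally show "L2norm (\<lambda>q. z q - fst (u k) q) \<le> snd (u k) + e" by simp
  qed
  \<comment> \<open>The limit point lies in all the balls, so for every \<open>k\<close> some
    \<open>p n z\<close> exceeds \<open>k\<close>, against the pointwise bound.\<close>
  obtain K where K: "\<And>n. p n z \<le> K" using pointwise[OF z] by blast
  obtain k where "K \<le> real k" using real_arch_simple by blast
  moreover obtain n where "real k < p n z"
    using u(3)[of k] inball[of "Suc k"] z unfolding Q_def by blast
  ultimately show False using K[of n] by linarith
qed

section \<open>Exponentials of pointwise dominated operators\<close>

definition expcoef :: "real \<Rightarrow> nat \<Rightarrow> complex" where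
  "expcoef t n = complex_of_real (t ^ n / fact n)"

lemma cmod_expcoef: "cmod (expcoef t n) = \<bar>t\<bar> ^ n / fact n"
  unfolding expcoef_def norm_of_real by (simp add: power_abs)

lemma expcoef_add: "expcoef (s + t) n = (\<Sum>i\<le>n. expcoef s i * expcoef t (n - i))"
  using exp_series_add_commuting[of s t n]
  by (simp add: expcoef_def divide_inverse mult.commute flip: of_real_mult of_real_sum)

lemma exp_series_sums: "(\<lambda>n. x ^ n / fact n) sums exp x" for x :: real
  using exp_converges[of x] by (simp add: divide_inverse mult.commute)

lemma expcoef_bound:
  assumes "\<And>n. cmod (c n) \<le> D * R ^ n" "R \<ge> 0"
  shows "cmod (expcoef t n * c n) \<le> D * ((\<bar>t\<bar> * R) ^ n / fact n)"
  using mult_left_mono[OF assms(1)[of n], of "\<bar>t\<bar> ^ n / fact n"]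
  by (simp add: norm_mult cmod_expcoef power_mult_distrib mult_ac)

lemma summable_expcoef:
  assumes "\<And>n. cmod (c n) \<le> D * R ^ n" "R \<ge> 0"
  shows "summable (\<lambda>n. cmod (expcoef t n * c n))"
proof (rule summable_comparison_test)
  show "\<exists>N. \<forall>n\<ge>N. norm (cmod (expcoef t n * c n)) \<le> D * ((\<bar>t\<bar> * R) ^ n / fact n)"
    using expcoef_bound[of c D R, OF assms] by auto
  show "summable (\<lambda>n. D * ((\<bar>t\<bar> * R) ^ n / fact n))"
    by (intro summable_mult sums_summable[OF exp_series_sums])
qed

text \<open>A Cauchy product: \<open>c\<close> depends on \<open>m + n\<close> only, so each
  antidiagonal collects a coefficient of \<open>s + t\<close> by the binomial theorem. The geometric
  bound on \<open>c\<close> makes the double family absolutely summable and justifies the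
  rearrangement. With \<open>c n\<close> the value of an iterate at one point, this becomes the
  semigroup law at that point.\<close>

lemma expcoef_double_series:
  assumes c: "\<And>n. cmod (c n) \<le> D * R ^ n" and R: "R \<ge> 0"
  shows "(\<Sum>m. expcoef s m * (\<Sum>n. expcoef t n * c (m + n))) = (\<Sum>n. expcoef (s + t) n * c n)"
proof -
  define x where "x = (\<lambda>(m, n). expcoef s m * (expcoef t n * c (m + n)))"
  define row where "row m = expcoef s m * (\<Sum>n. expcoef t n * c (m + n))" for m
  have D: "D \<ge> 0" using order_trans[OF norm_ge_zero c[of 0]] by simp
  have c': "cmod (c (m + n)) \<le> (D * R ^ m) * R ^ n" for m n
    using c[of "m + n"] by (simp add: power_add mult_ac)
  have has_sum_exp: "((\<lambda>n. u ^ n / fact n) has_sum exp u) UNIV" if "u \<ge> 0" for u :: real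
    using that exp_series_sums[of u]
    by (intro norm_summable_imp_has_sum) (auto simp: sums_summable)
  have "(\<lambda>p. norm (x p)) summable_on (UNIV \<times> UNIV)"
  proof (rule summable_on_comparison_test)
    show "(\<lambda>(m, n). (D * ((\<bar>s\<bar> * R) ^ m / fact m)) * ((\<bar>t\<bar> * R) ^ n / fact n)) summable_on (UNIV \<times> UNIV)"
    proof (rule summable_on_SigmaI[where g="\<lambda>m. (D * ((\<bar>s\<bar> * R) ^ m / fact m)) * exp (\<bar>t\<bar> * R)"])
      show "(\<lambda>m. (D * ((\<bar>s\<bar> * R) ^ m / fact m)) * exp (\<bar>t\<bar> * R)) summable_on UNIV"
        by (intro summable_on_cmult_left summable_on_cmult_right has_sum_imp_summable[OF has_sum_exp]) (use R in simp)
      show "((\<lambda>n. case (m, n) of (m, n) \<Rightarrow> (D * ((\<bar>s\<bar> * R) ^ m / fact m)) * ((\<bar>t\<bar> * R) ^ n / fact n)) has_sum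
          (D * ((\<bar>s\<bar> * R) ^ m / fact m)) * exp (\<bar>t\<bar> * R)) UNIV" for m
        unfolding prod.case by (rule has_sum_cmult_right[OF has_sum_exp]) (use R in simp)
    qed (use D R in auto)
  next
    fix p :: "nat \<times> nat"
    obtain m n where p: "p = (m, n)" by (cases p)
    have "norm (x p) = (\<bar>s\<bar> ^ m / fact m) * cmod (expcoef t n * c (m + n))"
      by (simp add: x_def p norm_mult cmod_expcoef)
    also have "\<dots> \<le> (\<bar>s\<bar> ^ m / fact m) * ((D * R ^ m) * ((\<bar>t\<bar> * R) ^ n / fact n))"
      by (intro mult_left_mono expcoef_bound[of "\<lambda>n. c (m + n)", OF c' R]) auto
    also have "\<dots> = (D * ((\<bar>s\<bar> * R) ^ m / fact m)) * ((\<bar>t\<bar> * R) ^ n / fact n)"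
      by (simp add: power_mult_distrib)
    finally show "norm (x p) \<le> (case p of (m, n) \<Rightarrow> (D * ((\<bar>s\<bar> * R) ^ m / fact m)) * ((\<bar>t\<bar> * R) ^ n / fact n))"
      by (simp add: p)
  qed auto
  then obtain S where S: "(x has_sum S) (UNIV \<times> UNIV)"
    using Infinite_Sum.abs_summable_summable[of x] unfolding summable_on_def by blast
  have "((\<lambda>n. x (m, n)) has_sum row m) UNIV" for m
  proof -
    have sm: "summable (\<lambda>n. cmod (expcoef t n * c (m + n)))"
      by (rule summable_expcoef[of "\<lambda>n. c (m + n)", OF c' R])
    have "((\<lambda>n. expcoef t n * c (m + n)) has_sum (\<Sum>n. expcoef t n * c (m + n))) UNIV"
      by (intro norm_summable_imp_has_sum sm summable_sums summable_norm_cancel[OF sm])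
    then show ?thesis
      unfolding x_def row_def by (simp add: has_sum_cmult_right)
  qed
  then have "(row has_sum S) UNIV" by (intro has_sum_SigmaD[OF S])
  then have 1: "suminf row = S" by (intro sums_unique[symmetric] has_sum_imp_sums)
  \<comment> \<open>The pairs \<open>(k, i)\<close> with \<open>i \<le> k\<close> run through the
    antidiagonals; on this set \<open>k - i\<close> is a true difference.\<close>
  have bij: "bij_betw (\<lambda>(k, i). (i, k - i)) (SIGMA k:UNIV. {..k::nat}) (UNIV \<times> UNIV)"
    by (rule bij_betw_byWitness[where f'="\<lambda>(m, n). (m + n, m)"]) auto
  have "((\<lambda>p. x (case p of (k, i) \<Rightarrow> (i, k - i))) has_sum S) (SIGMA k:UNIV. {..k})"
    using has_sum_reindex_bij_betw[OF bij] S by blast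
  from has_sum_SigmaD[OF this has_sum_finite]
  have "((\<lambda>k. \<Sum>i\<le>k. x (i, k - i)) has_sum S) UNIV" by simp
  also have "(\<lambda>k. \<Sum>i\<le>k. x (i, k - i)) = (\<lambda>k. expcoef (s + t) k * c k)"
    by (auto simp: x_def expcoef_add sum_distrib_right mult.assoc intro!: sum.cong)
  finally have "(\<Sum>k. expcoef (s + t) k * c k) = S" by (intro sums_unique[symmetric] has_sum_imp_sums)
  with 1 show ?thesis by (simp add: row_def[abs_def])
qed

text \<open>A Weierstrass test with a single profile \<open>H\<close>: the same majorant gives
  convergence at every point, membership in \<open>L2\<close> and the bound on the norm.\<close>

lemma L2_series:
  assumes f: "\<And>n. f n \<in> L2" and le: "\<And>n q. cmod (f n q) \<le> c n * H q"
    and H: "(\<lambda>q. complex_of_real (H q)) \<in> L2" "\<And>q. 0 \<le> H q"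
    and c: "summable c" "\<And>n. 0 \<le> c n"
  shows "(\<lambda>q. \<Sum>n. f n q) \<in> L2"
    and "cmod (\<Sum>n. f n q) \<le> suminf c * H q"
    and "L2norm (\<lambda>q. \<Sum>n. f n q) \<le> suminf c * L2norm (\<lambda>q. complex_of_real (H q))"
    and "summable (\<lambda>n. f n q)"
proof -
  note [measurable] = L2_measurable[OF f]
  have sum: "summable (\<lambda>n. cmod (f n q))" for q
    using le by (intro summable_comparison_test[OF _ summable_mult2[OF c(1), of "H q"]]) auto
  show "summable (\<lambda>n. f n q)" by (rule summable_norm_cancel[OF sum])
  show *: "cmod (\<Sum>n. f n q) \<le> suminf c * H q" for q
  proof -
    have "cmod (\<Sum>n. f n q) \<le> (\<Sum>n. cmod (f n q))" by (rule summable_norm[OF sum])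
    also have "\<dots> \<le> (\<Sum>n. c n * H q)" by (intro suminf_le le sum summable_mult2 c)
    also have "\<dots> = suminf c * H q" by (rule suminf_mult2[OF c(1), symmetric])
    finally show ?thesis .
  qed
  have "0 \<le> suminf c" using c by (simp add: suminf_nonneg)
  then have **: "cmod (\<Sum>n. f n q) \<le> cmod (complex_of_real (suminf c) * complex_of_real (H q))" for q
    using * H(2) by (simp add: norm_mult)
  show "(\<lambda>q. \<Sum>n. f n q) \<in> L2"
    by (rule L2_dominated[OF _ L2_mult(1)[OF H(1)] **]) measurable
  have "L2norm (\<lambda>q. \<Sum>n. f n q) \<le> L2norm (\<lambda>q. complex_of_real (suminf c) * complex_of_real (H q))"
    by (rule L2_dominated[OF _ L2_mult(1)[OF H(1)] **]) measurable
  then show "L2norm (\<lambda>q. \<Sum>n. f n q) \<le> suminf c * L2norm (\<lambda>q. complex_of_real (H q))"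
    using \<open>0 \<le> suminf c\<close> by (simp add: L2_mult(2)[OF H(1)])
qed

section \<open>The exponential of one dominated operator\<close>

text \<open>The pointwise bound makes the exponential series converge at every point, without passing to
  equivalence classes.\<close>

definition dominated_operator ::
  "((real^3 \<Rightarrow> complex) \<Rightarrow> real^3 \<Rightarrow> complex) \<Rightarrow> real \<Rightarrow> (real^3 \<Rightarrow> real) \<Rightarrow> bool" where
  "dominated_operator A a G \<longleftrightarrow>
     (\<forall>f\<in>L2. A f \<in> L2) \<and>
     (\<forall>f\<in>L2. \<forall>g\<in>L2. \<forall>b c. A (\<lambda>q. b * f q + c * g q) = (\<lambda>q. b * A f q + c * A g q)) \<and>
     (\<forall>f\<in>L2. \<forall>q. cmod (A f q) \<le> a * cmod (f q) + L2norm f * G q) \<and>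
     0 \<le> a \<and> (\<forall>q. 0 \<le> G q) \<and> (\<lambda>q. complex_of_real (G q)) \<in> L2"

context
  fixes A :: "(real^3 \<Rightarrow> complex) \<Rightarrow> real^3 \<Rightarrow> complex" and a :: real and G :: "real^3 \<Rightarrow> real"
  assumes dominated: "dominated_operator A a G"
begin

lemma A_L2: "f \<in> L2 \<Longrightarrow> A f \<in> L2"
  and A_lincomb: "f \<in> L2 \<Longrightarrow> g \<in> L2 \<Longrightarrow> A (\<lambda>q. b * f q + c * g q) = (\<lambda>q. b * A f q + c * A g q)"
  and A_bound: "f \<in> L2 \<Longrightarrow> cmod (A f q) \<le> a * cmod (f q) + L2norm f * G q"
  and a_nonneg: "0 \<le> a"
  and G_nonneg: "0 \<le> G q"
  and G_L2: "(\<lambda>q. complex_of_real (G q)) \<in> L2"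
  using dominated by (simp_all add: dominated_operator_def)

text \<open>\<open>a\<close> plus the norm of \<open>G\<close> bounds \<open>A\<close> on
  \<open>L2\<close>. The summand 1 absorbs the coefficient of \<open>cmod (f q)\<close> in
  \<open>maj\<close> and makes multiplication by \<open>opbound\<close> nondecreasing on nonnegative
  numbers.\<close>

definition opbound where "opbound = a + L2norm (\<lambda>q. complex_of_real (G q)) + 1"

text \<open>One profile for all iterates: besides multiples of the local value, \<open>A\<close>
  only adds multiples of \<open>G\<close>, so every \<open>(A ^^ n) f\<close> stays below a constant
  times this function.\<close>

definition maj where "maj f q = cmod (f q) + L2norm f * G q"

definition expA where "expA t f q = (\<Sum>n. expcoef t n * (A ^^ n) f q)"

lemma opbound_ge: "1 \<le> opbound" "a \<le> opbound" "0 \<le> opbound"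
  using a_nonneg by (auto simp: opbound_def)

lemma maj_nonneg: "0 \<le> maj f q"
  using G_nonneg by (simp add: maj_def)

lemma maj_L2:
  assumes "f \<in> L2"
  shows "(\<lambda>q. complex_of_real (maj f q)) \<in> L2"
    and "L2norm (\<lambda>q. complex_of_real (maj f q)) \<le> opbound * L2norm f"
proof -
  have eq: "(\<lambda>q. complex_of_real (maj f q)) =
      (\<lambda>q. complex_of_real (cmod (f q)) + complex_of_real (L2norm f) * complex_of_real (G q))"
    by (simp add: maj_def)
  show "(\<lambda>q. complex_of_real (maj f q)) \<in> L2"
    unfolding eq by (intro L2_add L2_mult G_L2 L2_cmod assms)
  have "L2norm (\<lambda>q. complex_of_real (maj f q)) \<le>
      L2norm f + L2norm f * L2norm (\<lambda>q. complex_of_real (G q))"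
    unfolding eq
    using L2_triangle[OF L2_cmod(1)[OF assms] L2_mult(1)[OF G_L2, of "complex_of_real (L2norm f)"]]
    by (simp add: L2_mult(2)[OF G_L2] L2_cmod(2)[OF assms])
  also have "\<dots> \<le> opbound * L2norm f"
    using mult_right_mono[OF a_nonneg, of "L2norm f"] by (simp add: opbound_def algebra_simps)
  finally show "L2norm (\<lambda>q. complex_of_real (maj f q)) \<le> opbound * L2norm f" .
qed

lemma A_norm:
  assumes "f \<in> L2"
  shows "L2norm (A f) \<le> opbound * L2norm f"
proof -
  let ?g = "\<lambda>q. complex_of_real a * complex_of_real (cmod (f q)) + complex_of_real (L2norm f) * complex_of_real (G q)"
  have "L2norm (A f) \<le> L2norm ?g"
  proof (rule L2_dominated(2))
    show "A f \<in> borel_measurable borel" by (rule L2_measurable[OF A_L2[OF assms]])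
    show "?g \<in> L2" by (intro L2_add L2_mult G_L2 L2_cmod assms)
    show "cmod (A f q) \<le> cmod (?g q)" for q
    proof -
      have "?g q = complex_of_real (a * cmod (f q) + L2norm f * G q)" by simp
      then have "cmod (?g q) = a * cmod (f q) + L2norm f * G q"
        using a_nonneg G_nonneg[of q] by (metis abs_of_nonneg add_nonneg_nonneg L2norm_nonneg mult_nonneg_nonneg norm_ge_zero norm_of_real)
      then show ?thesis using A_bound[OF assms] by simp
    qed
  qed
  also have "\<dots> \<le> a * L2norm f + L2norm f * L2norm (\<lambda>q. complex_of_real (G q))"
    using L2_triangle[OF L2_mult(1)[OF L2_cmod(1)[OF assms], of "complex_of_real a"]
        L2_mult(1)[OF G_L2, of "complex_of_real (L2norm f)"]] a_nonneg
    by (simp add: L2_mult(2)[OF G_L2] L2_mult(2)[OF L2_cmod(1)[OF assms]] L2_cmod(2)[OF assms])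
  also have "\<dots> \<le> opbound * L2norm f"
    by (simp add: opbound_def algebra_simps)
  finally show ?thesis .
qed

lemma pow_L2: "f \<in> L2 \<Longrightarrow> (A ^^ n) f \<in> L2"
  by (induction n) (auto intro: A_L2)

lemma pow_norm: "f \<in> L2 \<Longrightarrow> L2norm ((A ^^ n) f) \<le> opbound ^ n * L2norm f"
proof (induction n)
  case (Suc n)
  have "L2norm ((A ^^ Suc n) f) \<le> opbound * L2norm ((A ^^ n) f)"
    using A_norm[OF pow_L2[OF Suc.prems]] by simp
  also have "\<dots> \<le> opbound * (opbound ^ n * L2norm f)"
    using Suc opbound_ge by (intro mult_left_mono) auto
  finally show ?case by simp
qed simp

text \<open>Each application of \<open>A\<close> contributes a local term and a term from the norm
  of the previous iterate. Both are at most \<open>opbound * (2 * opbound) ^ n\<close> times the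
  profile, whence the factor 2 per step.\<close>

lemma pow_bound:
  assumes "f \<in> L2"
  shows "cmod ((A ^^ n) f q) \<le> (2 * opbound) ^ n * maj f q"
proof (induction n)
  case 0 then show ?case using G_nonneg by (simp add: maj_def)
next
  case (Suc n)
  have "cmod ((A ^^ Suc n) f q) \<le> a * cmod ((A ^^ n) f q) + L2norm ((A ^^ n) f) * G q"
    using A_bound[OF pow_L2[OF assms]] by simp
  also have "\<dots> \<le> opbound * ((2 * opbound) ^ n * maj f q) + opbound ^ n * L2norm f * G q"
    using Suc pow_norm[OF assms] opbound_ge G_nonneg a_nonneg
    by (intro add_mono mult_mono) auto
  also have "opbound ^ n * L2norm f * G q \<le> (opbound * (2 * opbound) ^ n) * maj f q"
  proof -
    have "opbound ^ n \<le> (2 * opbound) ^ n" using opbound_ge by (intro power_mono) auto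
    also have "\<dots> \<le> opbound * (2 * opbound) ^ n" using mult_right_mono[OF opbound_ge(1), of "(2 * opbound) ^ n"] opbound_ge by simp
    finally have "opbound ^ n * (L2norm f * G q) \<le> (opbound * (2 * opbound) ^ n) * maj f q"
      using G_nonneg opbound_ge by (intro mult_mono) (auto simp: maj_def)
    then show ?thesis by (simp add: mult.assoc)
  qed
  also have "opbound * ((2 * opbound) ^ n * maj f q) + (opbound * (2 * opbound) ^ n) * maj f q = (2 * opbound) ^ Suc n * maj f q"
    by simp
  finally show ?case by simp
qed

lemma A_zero: "A (\<lambda>q. 0) = (\<lambda>q. 0)"
  using A_lincomb[OF L2_zero(1) L2_zero(1), of 0 0] by simp

lemma A_add: "f \<in> L2 \<Longrightarrow> g \<in> L2 \<Longrightarrow> A (\<lambda>q. f q + g q) = (\<lambda>q. A f q + A g q)"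
  using A_lincomb[of f g 1 1] by simp

lemma A_sum:
  fixes f :: "nat \<Rightarrow> real^3 \<Rightarrow> complex"
  assumes "\<And>n. f n \<in> L2"
  shows "A (\<lambda>q. \<Sum>n<N. f n q) = (\<lambda>q. \<Sum>n<N. A (f n) q)"
proof (induction N)
  case (Suc N)
  then show ?case using A_add[OF L2_sum[of "{..<N}" f] assms[of N]] assms by simp
qed (simp add: A_zero)

text \<open>Continuity in the seminorm says nothing at a fixed point. The domination does: at
  \<open>q\<close>, the image of the tail is at most the tail sum of \<open>c\<close> times a number
  depending on \<open>q\<close> only.\<close>

lemma A_series:
  assumes f: "\<And>n. f n \<in> L2" and le: "\<And>n q. cmod (f n q) \<le> c n * H q"
    and H: "(\<lambda>q. complex_of_real (H q)) \<in> L2" "\<And>q. 0 \<le> H q"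
    and c: "summable c" "\<And>n. 0 \<le> c n"
  shows "A (\<lambda>q. \<Sum>n. f n q) q = (\<Sum>n. A (f n) q)"
proof -
  define tail where "tail N q = (\<Sum>n. f (n + N) q)" for N q
  define r where "r N = (\<Sum>n. c (n + N))" for N
  have c': "summable (\<lambda>n. c (n + N))" for N using c(1) by (simp add: summable_iff_shift)
  have tail: "tail N \<in> L2" "cmod (tail N q) \<le> r N * H q"
    "L2norm (tail N) \<le> r N * L2norm (\<lambda>q. complex_of_real (H q))" for N q
    unfolding tail_def r_def
    by (rule L2_series[of "\<lambda>n. f (n + N)", OF f le H c' c(2)])+
  have split: "(\<lambda>q. \<Sum>n. f n q) = (\<lambda>q. (\<Sum>n<N. f n q) + tail N q)" for N
    unfolding tail_def
    using suminf_split_initial_segment[OF L2_series(4)[OF f le H c], of _ N] by (simp add: add.commute)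
  have A_split: "A (\<lambda>q. \<Sum>n. f n q) q = (\<Sum>n<N. A (f n) q) + A (tail N) q" for N
    by (subst split[of N], subst A_add) (auto simp: f tail A_sum intro!: L2_sum)
  have "r \<longlonglongrightarrow> 0" unfolding r_def using suminf_exist_split2[OF c(1)] .
  define K where "K = a * H q + L2norm (\<lambda>q. complex_of_real (H q)) * G q"
  have "cmod (A (tail N) q) \<le> r N * K" for N
  proof -
    have "cmod (A (tail N) q) \<le> a * cmod (tail N q) + L2norm (tail N) * G q"
      by (rule A_bound[OF tail(1)])
    also have "\<dots> \<le> a * (r N * H q) + (r N * L2norm (\<lambda>q. complex_of_real (H q))) * G q"
      using a_nonneg G_nonneg tail by (intro add_mono mult_left_mono mult_right_mono) auto
    also have "\<dots> = r N * K" by (simp add: K_def algebra_simps)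
    finally show ?thesis .
  qed
  moreover have "(\<lambda>N. r N * K) \<longlonglongrightarrow> 0" using tendsto_mult_right[OF \<open>r \<longlonglongrightarrow> 0\<close>, of K] by simp
  ultimately have "(\<lambda>N. A (tail N) q) \<longlonglongrightarrow> 0"
    by (intro Lim_null_comparison[of "\<lambda>N. A (tail N) q" "\<lambda>N. r N * K"]) auto
  moreover have "(\<Sum>n<N. A (f n) q) = A (\<lambda>q. \<Sum>n. f n q) q - A (tail N) q" for N
    using A_split[of N] by simp
  ultimately have "(\<lambda>N. \<Sum>n<N. A (f n) q) \<longlonglongrightarrow> A (\<lambda>q. \<Sum>n. f n q) q"
    using tendsto_diff[OF tendsto_const[of "A (\<lambda>q. \<Sum>n. f n q) q"], of "\<lambda>N. A (tail N) q" 0] by simp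
  then show ?thesis by (simp add: sums_def sums_unique)
qed

lemma pow_series:
  assumes f: "\<And>n. f n \<in> L2" and le: "\<And>n q. cmod (f n q) \<le> c n * H q"
    and H: "(\<lambda>q. complex_of_real (H q)) \<in> L2" "\<And>q. 0 \<le> H q"
    and c: "summable c" "\<And>n. 0 \<le> c n"
  shows "(A ^^ m) (\<lambda>q. \<Sum>n. f n q) = (\<lambda>q. \<Sum>n. (A ^^ m) (f n) q)"
proof (induction m)
  case (Suc m)
  define h where "h = L2norm (\<lambda>q. complex_of_real (H q))"
  \<comment> \<open>The iterates of the terms need a larger profile: \<open>pow_bound\<close> brings
    in \<open>h * G\<close>, with \<open>h\<close> the norm of \<open>H\<close>. The coefficients
    \<open>c n\<close> stay the same, so \<open>A_series\<close> applies again.\<close>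
  define H' where "H' q = (2 * opbound) ^ m * (H q + h * G q)" for q
  have H'L2: "(\<lambda>q. complex_of_real (H' q)) \<in> L2"
  proof -
    have "(\<lambda>q. complex_of_real (H' q)) =
        (\<lambda>q. complex_of_real ((2 * opbound) ^ m) * (complex_of_real (H q) + complex_of_real h * complex_of_real (G q)))"
      by (simp add: H'_def)
    then show ?thesis by (simp only:) (intro L2_mult L2_add H G_L2)
  qed
  have H'0: "0 \<le> H' q" for q using opbound_ge H(2) G_nonneg by (simp add: H'_def h_def)
  have le': "cmod ((A ^^ m) (f n) q) \<le> c n * H' q" for n q
  proof -
    have "L2norm (f n) \<le> L2norm (\<lambda>q. complex_of_real (c n) * complex_of_real (H q))"
      using le c(2) H(2) by (intro L2_dominated(2)[OF L2_measurable[OF f] L2_mult(1)[OF H(1)]]) (simp add: norm_mult)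
    also have "\<dots> = c n * h" using c(2) by (simp add: L2_mult(2)[OF H(1)] h_def)
    finally have hn: "L2norm (f n) \<le> c n * h" .
    have "cmod ((A ^^ m) (f n) q) \<le> (2 * opbound) ^ m * maj (f n) q" by (rule pow_bound[OF f])
    also have "\<dots> \<le> (2 * opbound) ^ m * (c n * H q + c n * h * G q)"
      using opbound_ge hn G_nonneg le unfolding maj_def by (intro mult_left_mono add_mono mult_right_mono) auto
    also have "\<dots> = c n * H' q" by (simp add: H'_def algebra_simps)
    finally show ?thesis .
  qed
  show ?case
    unfolding funpow.simps o_apply Suc
    by (rule ext, rule A_series[of "\<lambda>n. (A ^^ m) (f n)", OF pow_L2[OF f] le' H'L2 H'0 c])
qed simp

lemma pow_lincomb:
  assumes "f \<in> L2" "g \<in> L2"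
  shows "(A ^^ n) (\<lambda>q. b * f q + c * g q) = (\<lambda>q. b * (A ^^ n) f q + c * (A ^^ n) g q)"
  by (induction n) (auto simp: A_lincomb pow_L2 assms)

lemma pow_mult: "f \<in> L2 \<Longrightarrow> (A ^^ n) (\<lambda>q. b * f q) = (\<lambda>q. b * (A ^^ n) f q)"
  using pow_lincomb[of f f n b 0] by simp

context
  fixes f assumes f: "f \<in> L2"
begin

lemma exp_term_bound: "cmod (expcoef t n * (A ^^ n) f q) \<le> ((\<bar>t\<bar> * (2 * opbound)) ^ n / fact n) * maj f q"
  using expcoef_bound[of "\<lambda>n. (A ^^ n) f q" "maj f q" "2 * opbound" t n] pow_bound[OF f] opbound_ge
  by (simp add: mult.commute)

lemma exp_coef_summable: "summable (\<lambda>n. (\<bar>t\<bar> * (2 * opbound)) ^ n / fact n)"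
  by (rule sums_summable[OF exp_series_sums])

lemma exp_coef_nonneg: "0 \<le> (\<bar>t\<bar> * (2 * opbound)) ^ n / fact n"
  using opbound_ge by simp

lemmas exp_series = L2_series[of "\<lambda>n q. expcoef t n * (A ^^ n) f q" for t,
    OF L2_mult(1)[OF pow_L2[OF f]] exp_term_bound maj_L2(1)[OF f] maj_nonneg exp_coef_summable exp_coef_nonneg]

lemma expA_L2: "expA t f \<in> L2"
  unfolding expA_def by (rule exp_series(1))

lemma expA_norm: "L2norm (expA t f) \<le> exp (\<bar>t\<bar> * (2 * opbound)) * opbound * L2norm f"
proof -
  have "L2norm (expA t f) \<le> exp (\<bar>t\<bar> * (2 * opbound)) * L2norm (\<lambda>q. complex_of_real (maj f q))"
    unfolding expA_def using exp_series(3)[of t] sums_unique[OF exp_series_sums] by simp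
  also have "\<dots> \<le> exp (\<bar>t\<bar> * (2 * opbound)) * (opbound * L2norm f)"
    by (intro mult_left_mono maj_L2 f) auto
  finally show ?thesis by (simp add: mult.assoc)
qed

lemma expA_zero: "expA 0 f = f"
proof -
  have "(\<Sum>n. expcoef 0 n * (A ^^ n) f q) = f q" for q
    using suminf_finite[of "{0}" "\<lambda>n. expcoef 0 n * (A ^^ n) f q"] by (simp add: expcoef_def)
  then show ?thesis by (simp add: expA_def fun_eq_iff)
qed

lemma expA_add: "expA (s + t) f = expA s (expA t f)"
proof
  fix q
  have "expA s (expA t f) q = (\<Sum>m. expcoef s m * (\<Sum>n. expcoef t n * (A ^^ (m + n)) f q))"
  proof -
    have "(A ^^ m) (expA t f) q = (\<Sum>n. expcoef t n * (A ^^ (m + n)) f q)" for m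
      unfolding expA_def
      by (subst pow_series[of "\<lambda>n q. expcoef t n * (A ^^ n) f q" for t,
            OF L2_mult(1)[OF pow_L2[OF f]] exp_term_bound maj_L2(1)[OF f] maj_nonneg exp_coef_summable exp_coef_nonneg])
        (simp add: pow_mult[OF pow_L2[OF f]] funpow_add)
    then show ?thesis by (simp add: expA_def[of s])
  qed
  also have "\<dots> = expA (s + t) f q"
    unfolding expA_def
    by (rule expcoef_double_series[where D="maj f q" and R="2 * opbound"])
      (use pow_bound[OF f] opbound_ge in \<open>auto simp: mult.commute\<close>)
  finally show "expA (s + t) f q = expA s (expA t f) q" by simp
qed

text \<open>The first two terms of the series are \<open>f\<close> and \<open>h * A f\<close>; each
  later one contains a power of \<open>h\<close> that is at most \<open>h\<^sup>2\<close> because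
  \<open>h \<le> 1\<close>. This quadratic error gives both the generator and the continuity at
  0.\<close>

lemma expA_derivative_bound:
  assumes h: "0 \<le> h" "h \<le> 1"
  shows "L2norm (\<lambda>q. expA h f q - f q - complex_of_real h * A f q) \<le>
    h\<^sup>2 * ((2 * opbound)\<^sup>2 * exp (2 * opbound) * (opbound * L2norm f))"
proof -
  define K where "K = h\<^sup>2 * ((2 * opbound)\<^sup>2 * exp (2 * opbound))"
  have K: "K \<ge> 0" by (simp add: K_def)
  have bound: "cmod (expA h f q - f q - complex_of_real h * A f q) \<le> K * maj f q" for q
  proof -
    let ?u = "\<lambda>n. expcoef h n * (A ^^ n) f q"
    have eq: "expA h f q - f q - complex_of_real h * A f q = (\<Sum>n. ?u (n + 2))"
      using suminf_split_initial_segment[OF exp_series(4)[of h q], of 2]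
      by (simp add: expA_def lessThan_Suc eval_nat_numeral expcoef_def)
    have le: "cmod (?u (n + 2)) \<le> h\<^sup>2 * (2 * opbound)\<^sup>2 * maj f q * ((2 * opbound) ^ n / fact n)" for n
    proof -
      have "cmod (?u (n + 2)) \<le> ((h * (2 * opbound)) ^ (n + 2) / fact (n + 2)) * maj f q"
        using exp_term_bound[of h "n + 2" q] h by simp
      also have "\<dots> \<le> (h\<^sup>2 * (2 * opbound) ^ (n + 2) / fact n) * maj f q"
      proof (intro mult_right_mono frac_le maj_nonneg)
        have "h ^ (n + 2) \<le> h\<^sup>2" using h by (intro power_decreasing) auto
        then show "(h * (2 * opbound)) ^ (n + 2) \<le> h\<^sup>2 * (2 * opbound) ^ (n + 2)"
          unfolding power_mult_distrib using opbound_ge by (intro mult_right_mono) auto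
      qed (use opbound_ge in \<open>auto intro!: fact_mono simp del: fact_Suc add_2_eq_Suc'\<close>)
      also have "\<dots> = h\<^sup>2 * (2 * opbound)\<^sup>2 * maj f q * ((2 * opbound) ^ n / fact n)"
        unfolding power_add by (simp add: divide_inverse mult_ac)
      finally show ?thesis .
    qed
    have sums: "(\<lambda>n. h\<^sup>2 * (2 * opbound)\<^sup>2 * maj f q * ((2 * opbound) ^ n / fact n)) sums (h\<^sup>2 * (2 * opbound)\<^sup>2 * maj f q * exp (2 * opbound))"
      by (intro sums_mult exp_series_sums)
    have "cmod (\<Sum>n. ?u (n + 2)) \<le> (\<Sum>n. h\<^sup>2 * (2 * opbound)\<^sup>2 * maj f q * ((2 * opbound) ^ n / fact n))"
      by (rule norm_suminf_le[OF le sums_summable[OF sums]])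
    also have "\<dots> = K * maj f q" using sums_unique[OF sums] by (simp add: K_def mult_ac)
    finally show ?thesis unfolding eq .
  qed
  have "L2norm (\<lambda>q. expA h f q - f q - complex_of_real h * A f q) \<le>
      L2norm (\<lambda>q. complex_of_real K * complex_of_real (maj f q))"
    by (rule L2_dominated(2)) (use bound K maj_nonneg[of f] in
        \<open>auto simp: norm_mult intro!: L2_mult maj_L2 L2_measurable L2_diff expA_L2 A_L2 f\<close>)
  also have "\<dots> \<le> K * (opbound * L2norm f)"
    using K by (simp add: L2_mult(2)[OF maj_L2(1)[OF f]] mult_left_mono maj_L2(2)[OF f])
  finally show ?thesis by (simp add: K_def mult.assoc)
qed

end

lemma expA_lincomb:
  assumes f: "f \<in> L2" and g: "g \<in> L2"
  shows "expA t (\<lambda>q. b * f q + c * g q) = (\<lambda>q. b * expA t f q + c * expA t g q)"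
proof
  fix q
  note sf = exp_series(4)[OF f, of t q] and sg = exp_series(4)[OF g, of t q]
  have "expA t (\<lambda>q. b * f q + c * g q) q =
      (\<Sum>n. b * (expcoef t n * (A ^^ n) f q) + c * (expcoef t n * (A ^^ n) g q))"
    unfolding expA_def pow_lincomb[OF f g] by (simp add: algebra_simps)
  also have "\<dots> = b * expA t f q + c * expA t g q"
    unfolding expA_def
    by (subst suminf_add[symmetric]) (auto simp: suminf_mult sf sg intro!: summable_mult)
  finally show "expA t (\<lambda>q. b * f q + c * g q) q = b * expA t f q + c * expA t g q" .
qed

text \<open>The norm of \<open>f - g\<close> vanishes, and with it the \<open>G\<close> term of the
  domination. What is left forces \<open>A f\<close> and \<open>A g\<close> to agree wherever
  \<open>f\<close> and \<open>g\<close> do.\<close>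

lemma A_cong:
  assumes "f \<in> L2" "g \<in> L2" "ae_eq f g"
  shows "ae_eq (A f) (A g)"
proof -
  let ?d = "\<lambda>q. f q - g q"
  have d: "?d \<in> L2" by (intro L2_diff assms)
  have "L2norm ?d = L2norm (\<lambda>q. 0)"
    using assms(3) d by (intro L2norm_cong_AE) (auto simp: ae_eq_def L2_measurable)
  then have "cmod (A ?d q) \<le> a * cmod (f q - g q)" for q
    using A_bound[OF d, of q] by (simp add: L2_zero)
  moreover have "A ?d q = A f q - A g q" for q
    using A_lincomb[OF assms(1,2), of 1 "-1"] by (simp add: fun_eq_iff)
  ultimately have "cmod (A f q - A g q) \<le> a * cmod (f q - g q)" for q by simp
  then have "f q = g q \<Longrightarrow> A f q = A g q" for q
    by (metis eq_iff_diff_eq_0 mult_zero_right norm_le_zero_iff norm_zero)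
  then show ?thesis
    using assms(3) unfolding ae_eq_def by (auto elim: eventually_mono)
qed

lemma expA_cong:
  assumes "f \<in> L2" "g \<in> L2" "ae_eq f g"
  shows "ae_eq (expA t f) (expA t g)"
proof -
  have "ae_eq ((A ^^ n) f) ((A ^^ n) g)" for n
    by (induction n) (auto simp: assms pow_L2 intro: A_cong)
  \<comment> \<open>The exceptional sets, one for each iterate, have a null union; off it the two
    series agree term by term.\<close>
  then have "AE q in lborel. \<forall>n. (A ^^ n) f q = (A ^^ n) g q"
    unfolding AE_all_countable by (simp add: ae_eq_def)
  then show ?thesis
    unfolding ae_eq_def by eventually_elim (simp add: expA_def)
qed

lemma expA_difference_quotient:
  assumes f: "f \<in> L2"
  shows "((\<lambda>h. L2norm (\<lambda>q. (expA h f q - f q) / complex_of_real h - A f q)) \<longlongrightarrow> 0) (at_right 0)"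
proof (rule tendsto_sandwich[OF _ _ tendsto_const])
  define K where "K = (2 * opbound)\<^sup>2 * exp (2 * opbound) * (opbound * L2norm f)"
  show "\<forall>\<^sub>F h in at_right 0. L2norm (\<lambda>q. (expA h f q - f q) / complex_of_real h - A f q) \<le> h * K"
    using eventually_at_right_real[of 0 1, OF zero_less_one]
  proof eventually_elim
    case (elim h)
    have "L2norm (\<lambda>q. (expA h f q - f q) / complex_of_real h - A f q) =
        L2norm (\<lambda>q. complex_of_real (1 / h) * (expA h f q - f q - complex_of_real h * A f q))"
      using elim by (simp add: field_simps)
    also have "\<dots> = 1 / h * L2norm (\<lambda>q. expA h f q - f q - complex_of_real h * A f q)"
      using elim by (subst L2_mult(2)) (auto intro!: L2_mult L2_diff expA_L2 A_L2 f simp: norm_divide)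
    also have "\<dots> \<le> 1 / h * (h\<^sup>2 * K)"
      unfolding K_def using elim by (intro mult_left_mono expA_derivative_bound f) auto
    also have "\<dots> = h * K" using elim by (simp add: power2_eq_square)
    finally show ?case .
  qed
  have "((\<lambda>h. h * K) \<longlongrightarrow> 0 * K) (at_right 0)" by (intro tendsto_intros)
  then show "((\<lambda>h. h * K) \<longlongrightarrow> 0) (at_right 0)" by simp
qed simp

lemma expA_continuous:
  assumes f: "f \<in> L2"
  shows "((\<lambda>h. L2norm (\<lambda>q. expA h f q - f q)) \<longlongrightarrow> 0) (at_right 0)"
proof (rule tendsto_sandwich[OF _ _ tendsto_const])
  define K where "K = (2 * opbound)\<^sup>2 * exp (2 * opbound) * (opbound * L2norm f)"
  show "\<forall>\<^sub>F h in at_right 0. L2norm (\<lambda>q. expA h f q - f q) \<le> h\<^sup>2 * K + h * L2norm (A f)"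
    using eventually_at_right_real[of 0 1, OF zero_less_one]
  proof eventually_elim
    case (elim h)
    have "L2norm (\<lambda>q. expA h f q - f q) =
        L2norm (\<lambda>q. (expA h f q - f q - complex_of_real h * A f q) + complex_of_real h * A f q)" by simp
    also have "\<dots> \<le> L2norm (\<lambda>q. expA h f q - f q - complex_of_real h * A f q) + L2norm (\<lambda>q. complex_of_real h * A f q)"
      by (intro L2_triangle L2_mult L2_diff expA_L2 A_L2 f)
    also have "\<dots> \<le> h\<^sup>2 * K + h * L2norm (A f)"
      using expA_derivative_bound[OF f, of h] elim by (simp add: K_def L2_mult(2)[OF A_L2[OF f]])
    finally show ?case .
  qed
  have "((\<lambda>h. h\<^sup>2 * K + h * L2norm (A f)) \<longlongrightarrow> 0\<^sup>2 * K + 0 * L2norm (A f)) (at_right 0)"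
    by (intro tendsto_intros)
  then show "((\<lambda>h. h\<^sup>2 * K + h * L2norm (A f)) \<longlongrightarrow> 0) (at_right 0)" by simp
qed simp

lemma C0_semigroup_expA: "C0_semigroup expA"
  unfolding C0_semigroup_def
proof (intro conjI ballI allI impI)
  show "\<exists>K. \<forall>f\<in>L2. L2norm (expA t f) \<le> K * L2norm f" for t
    using expA_norm by blast
qed (auto simp: expA_L2 expA_lincomb expA_zero expA_add expA_cong expA_continuous, auto simp: ae_eq_def)

lemma has_generator_expA: "has_generator expA L2 A"
  unfolding has_generator_def using A_L2 expA_difference_quotient by blast

end

section \<open>Semigroups with a dissipative generator\<close>

text \<open>The inner product of \<open>complex\<close> as a real plane, hence the real part of the
  Hermitian product.\<close>

definition L2inner :: "(real^3 \<Rightarrow> complex) \<Rightarrow> (real^3 \<Rightarrow> complex) \<Rightarrow> real" where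
  "L2inner f g = (\<integral>q. f q \<bullet> g q \<partial>lborel)"

lemma L2inner_integrable:
  assumes f: "f \<in> L2" and g: "g \<in> L2"
  shows "integrable lborel (\<lambda>q. f q \<bullet> g q)"
proof (rule Bochner_Integration.integrable_bound[OF L2_Cauchy_Schwarz(1)[OF f g]])
  show "(\<lambda>q. f q \<bullet> g q) \<in> borel_measurable lborel"
    using L2_measurable[OF f] L2_measurable[OF g] by measurable
  show "AE q in lborel. norm (f q \<bullet> g q) \<le> norm (cmod (f q) * cmod (g q))"
    using Cauchy_Schwarz_ineq2 by (intro AE_I2) (simp add: abs_mult)
qed

lemma L2inner_le:
  assumes f: "f \<in> L2" and g: "g \<in> L2"
  shows "L2inner f g \<le> L2norm f * L2norm g"
proof -
  have "L2inner f g \<le> (\<integral>q. cmod (f q) * cmod (g q) \<partial>lborel)"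
    unfolding L2inner_def
    by (intro integral_mono L2inner_integrable L2_Cauchy_Schwarz(1) f g norm_cauchy_schwarz)
  also have "\<dots> \<le> L2norm f * L2norm g" by (rule L2_Cauchy_Schwarz(2)[OF f g])
  finally show ?thesis .
qed

lemma L2inner_add_right:
  assumes "f \<in> L2" "g \<in> L2" "k \<in> L2"
  shows "L2inner f (\<lambda>q. g q + k q) = L2inner f g + L2inner f k"
  unfolding L2inner_def inner_add_right
  by (intro Bochner_Integration.integral_add L2inner_integrable assms)

lemma L2norm_add_power2:
  assumes f: "f \<in> L2" and g: "g \<in> L2"
  shows "(L2norm (\<lambda>q. f q + complex_of_real h * g q))\<^sup>2 =
    (L2norm f)\<^sup>2 + 2 * h * L2inner f g + h\<^sup>2 * (L2norm g)\<^sup>2"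
proof -
  have "(cmod (f q + complex_of_real h * g q))\<^sup>2 =
      (cmod (f q))\<^sup>2 + 2 * h * (f q \<bullet> g q) + h\<^sup>2 * (cmod (g q))\<^sup>2" for q
    unfolding power2_norm_eq_inner scaleR_conv_of_real[symmetric]
    by (simp add: inner_add_left inner_add_right inner_commute power2_eq_square algebra_simps)
  then show ?thesis
    using L2_integrable[OF f] L2_integrable[OF g] L2inner_integrable[OF f g]
    by (simp add: L2norm_power2 L2inner_def)
qed

text \<open>An upper bound on right increments takes the place of differentiability. Allow a slack
  \<open>e * s\<close> and take the last time at which the inequality holds, which exists by
  compactness; if it came before \<open>t\<close>, the hypothesis would give a later one. Finally
  the slack tends to 0.\<close>

lemma nonincreasing_of_right_derivative_le_0:
  fixes \<phi> :: "real \<Rightarrow> real"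
  assumes t: "0 \<le> t" and cont: "continuous_on {0..t} \<phi>"
    and deriv: "\<And>s e. 0 \<le> s \<Longrightarrow> s < t \<Longrightarrow> e > 0 \<Longrightarrow> \<forall>\<^sub>F h in at_right 0. \<phi> (s + h) \<le> \<phi> s + e * h"
  shows "\<phi> t \<le> \<phi> 0"
proof -
  have "\<phi> t - e * t \<le> \<phi> 0" if e: "e > 0" for e
  proof -
    define S where "S = {s \<in> {0..t}. \<phi> s - e * s \<le> \<phi> 0}"
    have "closed S" unfolding S_def
      by (intro continuous_on_closed_Collect_le continuous_intros cont closed_atLeastAtMost)
    moreover have "bounded S" unfolding S_def by (rule bounded_subset[of "{0..t}"]) auto
    ultimately have "compact S" by (simp add: compact_eq_bounded_closed)
    moreover have "0 \<in> S" using t by (simp add: S_def)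
    ultimately obtain m where m: "m \<in> S" "\<And>s. s \<in> S \<Longrightarrow> s \<le> m"
      using compact_attains_sup[of S] by blast
    have "m = t"
    proof (rule ccontr)
      assume "m \<noteq> t"
      then have mt: "0 \<le> m" "m < t" using m(1) by (auto simp: S_def)
      have "\<forall>\<^sub>F h in at_right 0. h > 0 \<and> h < t - m \<and> \<phi> (m + h) \<le> \<phi> m + e * h"
        using deriv[OF mt e] eventually_at_right_real[of 0 "t - m"] mt by (auto elim: eventually_elim2)
      then obtain h where h: "h > 0" "h < t - m" "\<phi> (m + h) \<le> \<phi> m + e * h"
        using eventually_happens trivial_limit_at_right_real by (metis (mono_tags, lifting))
      then have "m + h \<in> S" using m(1) by (auto simp: S_def algebra_simps)
      then show False using m(2)[of "m + h"] h by simp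
    qed
    then show ?thesis using m(1) by (simp add: S_def)
  qed
  then have "\<phi> t \<le> \<phi> 0 + e" if "e > 0" for e
  proof -
    have "e / (t + 1) * t \<le> e" using that t by (simp add: divide_le_eq algebra_simps)
    then show ?thesis using \<open>\<And>e. e > 0 \<Longrightarrow> \<phi> t - e * t \<le> \<phi> 0\<close>[of "e / (t + 1)"] that t by simp
  qed
  then show ?thesis by (rule field_le_epsilon)
qed

lemma L2norm_cong:
  assumes "ae_eq f g" "f \<in> L2" "g \<in> L2"
  shows "L2norm f = L2norm g"
  using assms L2norm_cong_AE L2_measurable by blast

lemma ae_eq_arith:
  assumes "ae_eq f f'" "ae_eq g g'"
  shows "ae_eq (\<lambda>q. f q + g q) (\<lambda>q. f' q + g' q)" "ae_eq (\<lambda>q. f q - g q) (\<lambda>q. f' q - g' q)"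
    "ae_eq (\<lambda>q. c * f q) (\<lambda>q. c * f' q)"
  using assms unfolding ae_eq_def by (auto elim: eventually_elim2 eventually_mono)

section \<open>Orbits of an arbitrary strongly continuous semigroup\<close>

context
  fixes T assumes C0: "C0_semigroup T"
begin

lemma T_L2: "t \<ge> 0 \<Longrightarrow> f \<in> L2 \<Longrightarrow> T t f \<in> L2"
  and T_cong: "t \<ge> 0 \<Longrightarrow> f \<in> L2 \<Longrightarrow> g \<in> L2 \<Longrightarrow> ae_eq f g \<Longrightarrow> ae_eq (T t f) (T t g)"
  and T_lincomb: "t \<ge> 0 \<Longrightarrow> f \<in> L2 \<Longrightarrow> g \<in> L2 \<Longrightarrow>
    ae_eq (T t (\<lambda>q. a * f q + b * g q)) (\<lambda>q. a * T t f q + b * T t g q)"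
  and T_bounded: "t \<ge> 0 \<Longrightarrow> \<exists>C. \<forall>f\<in>L2. L2norm (T t f) \<le> C * L2norm f"
  and T_zero: "f \<in> L2 \<Longrightarrow> ae_eq (T 0 f) f"
  and T_add: "s \<ge> 0 \<Longrightarrow> t \<ge> 0 \<Longrightarrow> f \<in> L2 \<Longrightarrow> ae_eq (T (s + t) f) (T s (T t f))"
  and T_lim: "f \<in> L2 \<Longrightarrow> ((\<lambda>t. L2norm (\<lambda>q. T t f q - f q)) \<longlongrightarrow> 0) (at_right 0)"
  using C0 by (simp_all add: C0_semigroup_def)

lemma T_diff:
  assumes "t \<ge> 0" "f \<in> L2" "g \<in> L2"
  shows "ae_eq (T t (\<lambda>q. f q - g q)) (\<lambda>q. T t f q - T t g q)"
  using T_lincomb[OF assms, of 1 "-1"] by simp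

text \<open>The filter \<open>at_right 0\<close> leaves out time 0, where \<open>T_zero\<close>
  gives the value. With 0 included, time gaps \<open>\<bar>s - t\<bar>\<close> that may vanish can
  be inserted.\<close>

lemma T_lim_ex:
  assumes "f \<in> L2" "e > 0"
  obtains d where "d > 0" "\<And>h. 0 \<le> h \<Longrightarrow> h < d \<Longrightarrow> L2norm (\<lambda>q. T h f q - f q) < e"
proof -
  have "\<forall>\<^sub>F h in at_right 0. L2norm (\<lambda>q. T h f q - f q) < e"
    using T_lim[OF assms(1)] assms(2) by (rule order_tendstoD)
  then obtain d where d: "d > 0" "\<And>h. 0 < h \<Longrightarrow> h < d \<Longrightarrow> L2norm (\<lambda>q. T h f q - f q) < e"
    unfolding eventually_at_right_field by auto
  have "L2norm (\<lambda>q. T 0 f q - f q) = L2norm (\<lambda>q. 0)"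
    using T_zero[OF assms(1)]
    by (intro L2norm_cong L2_diff T_L2 L2_zero assms(1)) (auto simp: ae_eq_def)
  then have "L2norm (\<lambda>q. T h f q - f q) < e" if "0 \<le> h" "h < d" for h
    using d(2)[of h] that assms(2) by (cases "h = 0") (auto simp: L2_zero)
  with d(1) show thesis by (rule that)
qed

text \<open>Strong continuity is assumed only at \<open>0\<close> from the right; left continuity of the orbits
  needs this bound.\<close>

lemma T_locally_bounded:
  obtains d M where "d > 0" "M \<ge> 0" "\<And>h f. 0 \<le> h \<Longrightarrow> h \<le> d \<Longrightarrow> f \<in> L2 \<Longrightarrow> L2norm (T h f) \<le> M * L2norm f"
proof -
  \<comment> \<open>Otherwise there are times \<open>h n\<close> tending to 0 at which the operators
    stretch some function by more than \<open>n\<close>. Each orbit is bounded along these times,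
    being near \<open>f\<close> for all but finitely many of them, so
    \<open>L2_uniform_boundedness\<close> contradicts this growth.\<close>
  have "\<exists>n. \<forall>h. 0 \<le> h \<longrightarrow> h \<le> 1 / real (Suc n) \<longrightarrow> (\<forall>f\<in>L2. L2norm (T h f) \<le> real n * L2norm f)"
  proof (rule ccontr)
    assume "\<not> ?thesis"
    then have "\<forall>n. \<exists>h f. 0 \<le> h \<and> h \<le> 1 / real (Suc n) \<and> f \<in> L2 \<and> real n * L2norm f < L2norm (T h f)"
      by (metis not_le)
    then obtain h f where h: "\<And>n. 0 \<le> h n" "\<And>n. h n \<le> 1 / real (Suc n)"
      and f: "\<And>n. f n \<in> L2" and gt: "\<And>n. real n * L2norm (f n) < L2norm (T (h n) (f n))"
      by metis
    have "\<exists>K. \<forall>n. \<forall>g\<in>L2. L2norm (T (h n) g) \<le> K * L2norm g"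
    proof (rule L2_uniform_boundedness)
      fix n and f g :: "real^3 \<Rightarrow> complex" assume fg: "f \<in> L2" "g \<in> L2"
      have "L2norm (T (h n) (\<lambda>q. f q + g q)) = L2norm (\<lambda>q. T (h n) f q + T (h n) g q)"
        using T_lincomb[OF h(1) fg, of n 1 1] by (intro L2norm_cong T_L2 L2_add h fg) simp
      then show "L2norm (T (h n) (\<lambda>q. f q + g q)) \<le> L2norm (T (h n) f) + L2norm (T (h n) g)"
        using L2_triangle[OF T_L2[OF h(1) fg(1)] T_L2[OF h(1) fg(2)]] by simp
    next
      fix n c and f :: "real^3 \<Rightarrow> complex" assume f: "f \<in> L2"
      have "L2norm (T (h n) (\<lambda>q. complex_of_real c * f q)) = L2norm (\<lambda>q. complex_of_real c * T (h n) f q)"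
        using T_lincomb[OF h(1) f f, of n "complex_of_real c" 0] by (intro L2norm_cong T_L2 L2_mult h f) simp
      then show "L2norm (T (h n) (\<lambda>q. complex_of_real c * f q)) = \<bar>c\<bar> * L2norm (T (h n) f)"
        by (simp add: L2_mult(2)[OF T_L2[OF h(1) f]])
    next
      show "\<exists>C. \<forall>f\<in>L2. L2norm (T (h n) f) \<le> C * L2norm f" for n by (rule T_bounded[OF h(1)])
    next
      fix f :: "real^3 \<Rightarrow> complex" assume f: "f \<in> L2"
      obtain d where d: "d > 0" "\<And>h. 0 \<le> h \<Longrightarrow> h < d \<Longrightarrow> L2norm (\<lambda>q. T h f q - f q) < 1"
        using T_lim_ex[OF f zero_less_one] by blast
      obtain N where N: "1 / real (Suc N) < d" using reals_Archimedean[OF d(1)] by (auto simp: inverse_eq_divide)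
      have tl: "L2norm (T (h n) f) \<le> L2norm f + 1" if "n \<ge> N" for n
      proof -
        have "1 / real (Suc n) \<le> 1 / real (Suc N)" using that by (simp add: frac_le)
        then have "h n < d" using h(2)[of n] N by linarith
        then have "L2norm (\<lambda>q. T (h n) f q - f q) < 1" using d(2) h(1) by blast
        then show ?thesis using L2_triangle[OF L2_diff[OF T_L2[OF h(1) f] f] f, of n] by simp
      qed
      define K where "K = (\<Sum>n<N. L2norm (T (h n) f)) + L2norm f + 1"
      have "L2norm (T (h n) f) \<le> K" for n
      proof (cases "n < N")
        case True
        then have "L2norm (T (h n) f) \<le> (\<Sum>n<N. L2norm (T (h n) f))"
          by (intro member_le_sum) auto
        then show ?thesis using L2norm_nonneg[of f] unfolding K_def by linarith
      next
        case False
        then show ?thesis using tl[of n] sum_nonneg[of "{..<N}" "\<lambda>n. L2norm (T (h n) f)"] by (simp add: K_def)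
      qed
      then show "\<exists>K. \<forall>n. L2norm (T (h n) f) \<le> K" by blast
    qed
    then obtain K where K: "\<And>n g. g \<in> L2 \<Longrightarrow> L2norm (T (h n) g) \<le> K * L2norm g" by blast
    obtain n where "K \<le> real n" using real_arch_simple by blast
    then have "K * L2norm (f n) \<le> real n * L2norm (f n)" by (intro mult_right_mono) auto
    then show False using K[OF f, of n n] gt[of n] by linarith
  qed
  then obtain n where "\<And>h f. 0 \<le> h \<Longrightarrow> h \<le> 1 / real (Suc n) \<Longrightarrow> f \<in> L2 \<Longrightarrow> L2norm (T h f) \<le> real n * L2norm f"
    by blast
  then show thesis by (intro that[of "1 / real (Suc n)" "real n"]) auto
qed

text \<open>To the right of \<open>t\<close>, the difference \<open>T s f - T t f\<close> is almost
  everywhere \<open>T t\<close> applied to \<open>T (s - t) f - f\<close>. To the left the outer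
  operator would be \<open>T s\<close>, which varies with \<open>s\<close>; it is split into a fixed
  \<open>T t'\<close> and a \<open>T u\<close> with \<open>u \<le> d\<close>, which
  \<open>T_locally_bounded\<close> controls uniformly.\<close>

lemma T_continuous:
  assumes f: "f \<in> L2"
  shows "continuous_on {0..} (\<lambda>t. L2norm (T t f))"
proof -
  obtain d M where d: "d > 0" and M: "M \<ge> 0"
    "\<And>h f. 0 \<le> h \<Longrightarrow> h \<le> d \<Longrightarrow> f \<in> L2 \<Longrightarrow> L2norm (T h f) \<le> M * L2norm f"
    by (rule T_locally_bounded) blast
  have add_diff: "\<exists>K\<ge>0. \<forall>g\<in>L2. \<forall>k\<in>L2. L2norm (\<lambda>q. T s g q - T s k q) \<le> K * L2norm (\<lambda>q. g q - k q)" if s: "s \<ge> 0" for s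
  proof -
    obtain K where K: "\<And>f. f \<in> L2 \<Longrightarrow> L2norm (T s f) \<le> K * L2norm f" using T_bounded[OF s] by blast
    have "L2norm (\<lambda>q. T s g q - T s k q) \<le> \<bar>K\<bar> * L2norm (\<lambda>q. g q - k q)" if gk: "g \<in> L2" "k \<in> L2" for g k
    proof -
      have "L2norm (\<lambda>q. T s g q - T s k q) = L2norm (T s (\<lambda>q. g q - k q))"
        using T_diff[OF s gk] by (intro L2norm_cong[symmetric] T_L2 L2_diff s gk)
      also have "\<dots> \<le> K * L2norm (\<lambda>q. g q - k q)" by (intro K L2_diff gk)
      also have "\<dots> \<le> \<bar>K\<bar> * L2norm (\<lambda>q. g q - k q)" by (intro mult_right_mono) auto
      finally show ?thesis .
    qed
    then show ?thesis by (intro exI[of _ "\<bar>K\<bar>"]) auto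
  qed
  have "\<exists>K\<ge>0. \<exists>r>0. \<forall>s\<ge>0. \<bar>s - t\<bar> < r \<longrightarrow>
      L2norm (\<lambda>q. T s f q - T t f q) \<le> K * L2norm (\<lambda>q. T \<bar>s - t\<bar> f q - f q)" if t: "t \<ge> 0" for t
  proof -
    obtain K1 where K1: "K1 \<ge> 0" "\<And>g k. g \<in> L2 \<Longrightarrow> k \<in> L2 \<Longrightarrow> L2norm (\<lambda>q. T t g q - T t k q) \<le> K1 * L2norm (\<lambda>q. g q - k q)"
      using add_diff[OF t] by blast
    \<comment> \<open>\<open>r \<le> d\<close> keeps the time \<open>s - t'\<close> within reach of
      the local bound, and for positive \<open>t\<close> the bound \<open>r \<le> t\<close> makes
      \<open>t'\<close> equal to \<open>t - r\<close>. At \<open>t = 0\<close> only the right side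
      occurs.\<close>
    define r where "r = (if t = 0 then d else min d t)"
    have r: "r > 0" "r \<le> d" "t > 0 \<Longrightarrow> r \<le> t" using d t by (auto simp: r_def)
    define t' where "t' = max 0 (t - r)"
    have t': "t' \<ge> 0" "t > 0 \<Longrightarrow> t = t' + r" using r(3) by (auto simp: t'_def)
    obtain K2 where K2: "K2 \<ge> 0" "\<And>g k. g \<in> L2 \<Longrightarrow> k \<in> L2 \<Longrightarrow> L2norm (\<lambda>q. T t' g q - T t' k q) \<le> K2 * L2norm (\<lambda>q. g q - k q)"
      using add_diff[OF t'(1)] by blast
    have right: "L2norm (\<lambda>q. T s f q - T t f q) \<le> K1 * L2norm (\<lambda>q. T \<bar>s - t\<bar> f q - f q)" if st: "s \<ge> t" for s
    proof -
      have st0: "s - t \<ge> 0" using st by simp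
      have "ae_eq (T s f) (T t (T (s - t) f))" using T_add[OF t st0 f] by simp
      then have "L2norm (\<lambda>q. T s f q - T t f q) = L2norm (\<lambda>q. T t (T (s - t) f) q - T t f q)"
        by (intro L2norm_cong ae_eq_arith(2) L2_diff T_L2 f t st0 order.trans[OF t st]) (simp_all add: ae_eq_def)
      also have "\<dots> \<le> K1 * L2norm (\<lambda>q. T (s - t) f q - f q)"
        by (intro K1 T_L2 st0 f)
      finally show ?thesis using st by simp
    qed
    have left: "L2norm (\<lambda>q. T s f q - T t f q) \<le> (K2 * M) * L2norm (\<lambda>q. T \<bar>s - t\<bar> f q - f q)"
      if s: "s \<ge> 0" "s < t" "t - s < r" for s
    proof -
      have tpos: "t > 0" using s by simp
      define u where "u = s - t'"
      have u: "u \<ge> 0" "u \<le> d" "s = t' + u" "t - s \<ge> 0" "t = t' + (u + (t - s))"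
        using s t'(2)[OF tpos] r by (auto simp: u_def)
      define g where "g = T (t - s) f"
      have g: "g \<in> L2" unfolding g_def by (intro T_L2 u f)
      have us: "u + (t - s) \<ge> 0" using u by simp
      have "ae_eq (T t f) (T t' (T (u + (t - s)) f))"
        using T_add[OF t'(1) us f] u(5) by simp
      moreover have "ae_eq (T t' (T (u + (t - s)) f)) (T t' (T u g))"
        unfolding g_def by (intro T_cong T_add T_L2 t' u us f)
      ultimately have "ae_eq (T t f) (T t' (T u g))"
        unfolding ae_eq_def by (auto elim: eventually_elim2)
      moreover have "ae_eq (T s f) (T t' (T u f))" using T_add[OF t'(1) u(1) f] u(3) by simp
      ultimately have "L2norm (\<lambda>q. T s f q - T t f q) = L2norm (\<lambda>q. T t' (T u f) q - T t' (T u g) q)"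
        by (intro L2norm_cong ae_eq_arith(2) L2_diff T_L2 f g t s t' u)
      also have "\<dots> \<le> K2 * L2norm (\<lambda>q. T u f q - T u g q)"
        by (intro K2 T_L2 u f g)
      also have "L2norm (\<lambda>q. T u f q - T u g q) = L2norm (T u (\<lambda>q. f q - g q))"
        using T_diff[OF u(1) f g] by (intro L2norm_cong[symmetric] T_L2 L2_diff u f g)
      also have "K2 * \<dots> \<le> K2 * (M * L2norm (\<lambda>q. f q - g q))"
        by (intro mult_left_mono K2 M u L2_diff f g)
      also have "L2norm (\<lambda>q. f q - g q) = L2norm (\<lambda>q. T \<bar>s - t\<bar> f q - f q)"
        using s(2) by (simp add: L2norm_def norm_minus_commute g_def)
      finally show ?thesis by (simp add: mult.assoc)
    qed
    have "L2norm (\<lambda>q. T s f q - T t f q) \<le> (K1 + K2 * M) * L2norm (\<lambda>q. T \<bar>s - t\<bar> f q - f q)"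
      if s: "s \<ge> 0" "\<bar>s - t\<bar> < r" for s
    proof -
      have "0 \<le> K1 * L2norm (\<lambda>q. T \<bar>s - t\<bar> f q - f q)" "0 \<le> (K2 * M) * L2norm (\<lambda>q. T \<bar>s - t\<bar> f q - f q)"
        using K1 K2 M by auto
      then show ?thesis
        using right[of s] left[of s] s unfolding distrib_right by (cases "s \<ge> t") linarith+
    qed
    then show ?thesis using K1(1) K2(1) M(1) r(1) by (intro exI[of _ "K1 + K2 * M"] conjI exI[of _ r]) auto
  qed
  note near = this
  show ?thesis
    unfolding continuous_on_iff
  proof (intro ballI allI impI)
    fix t e :: real assume t: "t \<in> {0..}" and e: "e > 0"
    obtain K r where K: "K \<ge> 0" "r > 0" "\<And>s. s \<ge> 0 \<Longrightarrow> \<bar>s - t\<bar> < r \<Longrightarrow>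
        L2norm (\<lambda>q. T s f q - T t f q) \<le> K * L2norm (\<lambda>q. T \<bar>s - t\<bar> f q - f q)"
      using near[of t] t by auto
    have "e / (K + 1) > 0" using e K by simp
    then obtain d' where d': "d' > 0" "\<And>h. 0 \<le> h \<Longrightarrow> h < d' \<Longrightarrow> L2norm (\<lambda>q. T h f q - f q) < e / (K + 1)"
      using T_lim_ex[OF f] by blast
    show "\<exists>d>0. \<forall>s\<in>{0..}. dist s t < d \<longrightarrow> dist (L2norm (T s f)) (L2norm (T t f)) < e"
    proof (intro exI[of _ "min r d'"] conjI ballI impI)
      fix s assume s: "s \<in> {0..}" "dist s t < min r d'"
      have "dist (L2norm (T s f)) (L2norm (T t f)) \<le> L2norm (\<lambda>q. T s f q - T t f q)"
        unfolding dist_real_def using s t by (intro L2_triangle_rev T_L2 f) auto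
      also have "\<dots> \<le> K * L2norm (\<lambda>q. T \<bar>s - t\<bar> f q - f q)"
        using s by (intro K) (auto simp: dist_real_def)
      also have "\<dots> \<le> K * (e / (K + 1))"
        using d'(2)[of "\<bar>s - t\<bar>"] s K(1) by (intro mult_left_mono) (auto simp: dist_real_def)
      also have "\<dots> < e" using e K(1) by (simp add: field_simps)
      finally show "dist (L2norm (T s f)) (L2norm (T t f)) < e" .
    qed (use K d' in auto)
  qed
qed

text \<open>Write \<open>T h g\<close> as \<open>g + h * (B g + r h)\<close>, where
  \<open>L2norm (r h)\<close> tends to 0. Dissipativity leaves at most
  \<open>2 * h * (L2norm g * L2norm (r h))\<close> of the linear term in the squared norm, so its
  increments are eventually at most \<open>e * h\<close>. The semigroup law moves this from time 0
  to every time \<open>s\<close>.\<close>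

theorem dissipative_imp_contraction:
  assumes gen: "has_generator T L2 B"
    and diss: "\<And>f. f \<in> L2 \<Longrightarrow> L2inner f (B f) \<le> 0"
    and f: "f \<in> L2" and t: "t \<ge> 0"
  shows "L2norm (T t f) \<le> L2norm f"
proof -
  have B_L2: "B f \<in> L2" and B_lim:
    "((\<lambda>h. L2norm (\<lambda>q. (T h f q - f q) / complex_of_real h - B f q)) \<longlongrightarrow> 0) (at_right 0)"
    if "f \<in> L2" for f
    using gen that unfolding has_generator_def by blast+
  have step: "\<forall>\<^sub>F h in at_right 0. (L2norm (T h g))\<^sup>2 \<le> (L2norm g)\<^sup>2 + e * h"
    if g: "g \<in> L2" and e: "e > 0" for g e
  proof -
    define r where "r h q = (T h g q - g q) / complex_of_real h - B g q" for h q
    \<comment> \<open>This is the bound on the increment of the squared norm divided by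
      \<open>h\<close>; it tends to 0, hence drops below \<open>e\<close>.\<close>
    have "((\<lambda>h. 2 * (L2norm g * L2norm (r h)) + h * (L2norm (B g) + L2norm (r h))\<^sup>2) \<longlongrightarrow>
        2 * (L2norm g * 0) + 0 * (L2norm (B g) + 0)\<^sup>2) (at_right 0)"
      using B_lim[OF g] unfolding r_def by (intro tendsto_intros)
    then have "\<forall>\<^sub>F h in at_right 0. 2 * (L2norm g * L2norm (r h)) + h * (L2norm (B g) + L2norm (r h))\<^sup>2 < e"
      using e by (simp add: order_tendstoD)
    then show ?thesis
      using eventually_at_right_less[of "0::real"]
    proof eventually_elim
      case (elim h)
      define k where "k q = B g q + r h q" for q
      have r: "r h \<in> L2"
      proof -
        have "r h = (\<lambda>q. complex_of_real (1 / h) * (T h g q - g q) - B g q)" by (auto simp: r_def)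
        then show ?thesis using elim by (simp only:) (intro L2_mult L2_diff T_L2 g B_L2, simp)
      qed
      have k: "k \<in> L2" unfolding k_def by (intro L2_add B_L2 g r)
      have "(L2norm (T h g))\<^sup>2 = (L2norm (\<lambda>q. g q + complex_of_real h * k q))\<^sup>2"
        using elim by (simp add: k_def r_def)
      also have "\<dots> = (L2norm g)\<^sup>2 + 2 * h * L2inner g k + h\<^sup>2 * (L2norm k)\<^sup>2"
        by (rule L2norm_add_power2[OF g k])
      also have "\<dots> \<le> (L2norm g)\<^sup>2 + 2 * h * (L2norm g * L2norm (r h)) + h\<^sup>2 * (L2norm (B g) + L2norm (r h))\<^sup>2"
      proof (intro add_mono mult_left_mono power_mono)
        show "L2inner g k \<le> L2norm g * L2norm (r h)"
          using L2inner_add_right[OF g B_L2[OF g] r] diss[OF g] L2inner_le[OF g r] by (simp add: k_def[abs_def])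
        show "L2norm k \<le> L2norm (B g) + L2norm (r h)"
          using L2_triangle[OF B_L2[OF g] r] by (simp add: k_def[abs_def])
      qed (use elim in auto)
      also have "\<dots> = (L2norm g)\<^sup>2 + (2 * (L2norm g * L2norm (r h)) + h * (L2norm (B g) + L2norm (r h))\<^sup>2) * h"
        by (simp add: algebra_simps power2_eq_square)
      also have "\<dots> \<le> (L2norm g)\<^sup>2 + e * h"
        using elim by (intro add_left_mono mult_right_mono) auto
      finally show ?case .
    qed
  qed
  have "(L2norm (T t f))\<^sup>2 \<le> (L2norm (T 0 f))\<^sup>2"
  proof (rule nonincreasing_of_right_derivative_le_0[OF t, where \<phi>="\<lambda>s. (L2norm (T s f))\<^sup>2"])
    show "continuous_on {0..t} (\<lambda>s. (L2norm (T s f))\<^sup>2)"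
      by (intro continuous_on_power continuous_on_subset[OF T_continuous[OF f]]) auto
    fix s e :: real assume s: "0 \<le> s" "s < t" and e: "e > 0"
    have Ts: "T s f \<in> L2" by (intro T_L2 s f)
    show "\<forall>\<^sub>F h in at_right 0. (L2norm (T (s + h) f))\<^sup>2 \<le> (L2norm (T s f))\<^sup>2 + e * h"
      using step[OF Ts e] eventually_at_right_less[of "0::real"]
    proof eventually_elim
      case (elim h)
      have "L2norm (T (h + s) f) = L2norm (T h (T s f))"
        using elim s by (intro L2norm_cong T_add T_L2 f) auto
      then show ?case using elim by (simp add: add.commute)
    qed
  qed
  also have "L2norm (T 0 f) = L2norm f"
    by (intro L2norm_cong T_zero T_L2 f) simp
  finally show ?thesis by simp
qed

end

section \<open>Moments of the Juettner distribution\<close>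

text \<open>Lebesgue measure is determined by its values on boxes, and the preimage of a box is its
  image under the inverse transformation, which has the same measure. The moments use it for
  reflections and permutations of coordinates.\<close>

lemma distr_lborel_orthogonal_transformation:
  fixes f :: "real^'n::{finite,wellorder} \<Rightarrow> real^'n::_"
  assumes f: "orthogonal_transformation f"
  shows "distr lborel borel f = lborel"
proof (rule lborel_eqI[symmetric])
  have [measurable]: "f \<in> borel_measurable borel"
    using f by (intro borel_measurable_continuous_onI linear_continuous_on linear_linear[THEN iffD2])
      (simp add: orthogonal_transformation_def)
  fix l u :: "real^'n::{finite,wellorder}" assume lu: "\<And>b. b \<in> Basis \<Longrightarrow> l \<bullet> b \<le> u \<bullet> b"
  define g where "g = inv f"
  have bij: "bij f" using f by (rule orthogonal_transformation_bij)
  have g: "orthogonal_transformation g" unfolding g_def using f by (rule orthogonal_transformation_inv)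
  have vim: "f -` box l u = g ` box l u" unfolding g_def using bij by (rule bij_vimage_eq_inv_image)
  have meas: "f -` box l u \<in> sets borel" by (rule measurable_sets_borel[of f borel]) auto
  have "emeasure (distr lborel borel f) (box l u) = emeasure lborel (f -` box l u)"
    by (subst emeasure_distr) auto
  also have "\<dots> = emeasure lebesgue (g ` box l u)"
    using meas by (simp add: vim)
  also have "\<dots> = ennreal (measure lebesgue (g ` box l u))"
    by (intro emeasure_eq_measure2 fmeasurableD2 measurable_orthogonal_image[OF g]) auto
  also have "\<dots> = ennreal (measure lebesgue (box l u))"
    by (subst measure_orthogonal_image[OF g]) auto
  also have "\<dots> = (\<Prod>b\<in>Basis. (u - l) \<bullet> b)"
    using lu by (simp add: measure_lborel_box inner_diff_left)
  finally show "emeasure (distr lborel borel f) (box l u) = (\<Prod>b\<in>Basis. (u - l) \<bullet> b)" .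
qed simp

lemma emeasure_cball_3:
  assumes "r \<ge> 0"
  shows "emeasure lborel (cball (0::real^3) r) = ennreal (4 / 3 * pi * r ^ 3)"
  using emeasure_cball[OF assms, of "0::real^3"] by (simp add: unit_ball_vol_3)

lemma sinh_cosh_measurable [measurable]:
  "(sinh :: real \<Rightarrow> real) \<in> borel_measurable borel" "(cosh :: real \<Rightarrow> real) \<in> borel_measurable borel"
  "(arsinh :: real \<Rightarrow> real) \<in> borel_measurable borel"
  by (intro borel_measurable_continuous_onI continuous_intros)+

text \<open>Polar coordinates with radius \<open>norm p = sinh x\<close>, so that \<open>q0 p = cosh x\<close>.\<close>

lemma distr_lborel_rapidity:
  "distr lborel borel (\<lambda>p::real^3. arsinh (norm p)) =
    density lborel (\<lambda>x. ennreal (4 * pi * (sinh x)\<^sup>2 * cosh x) * indicator {0..} x)"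
  (is "?M = ?N")
proof (rule measure_eqI_generator_eq)
  let ?E = "range (\<lambda>a. {..a::real})"
  have M: "emeasure ?M {..x} = (if x < 0 then 0 else ennreal (4 / 3 * pi * (sinh x) ^ 3))" for x
  proof -
    have "emeasure ?M {..x} = emeasure lborel ((\<lambda>p::real^3. arsinh (norm p)) -` {..x})"
      by (subst emeasure_distr) auto
    \<comment> \<open>The preimage is a ball of radius \<open>sinh x\<close>, empty for negative
      \<open>x\<close>; the density in the statement is the derivative of its volume.\<close>
    also have "(\<lambda>p::real^3. arsinh (norm p)) -` {..x} = cball 0 (sinh x)"
      using sinh_real_le_iff[of "arsinh (norm p)" x for p :: "real^3"] by (auto simp: dist_norm)
    also have "emeasure lborel (cball (0::real^3) (sinh x)) = (if x < 0 then 0 else ennreal (4 / 3 * pi * (sinh x) ^ 3))"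
    proof (cases "x < 0")
      case False then show ?thesis using emeasure_cball_3[of "sinh x"] by simp
    qed simp
    finally show ?thesis .
  qed
  show "emeasure ?M X = emeasure ?N X" if X: "X \<in> ?E" for X
  proof -
    obtain x where x: "X = {..x}" using X by blast
    have "emeasure ?N X = (\<integral>\<^sup>+y. ennreal (4 * pi * (sinh y)\<^sup>2 * cosh y) * indicator {0..x} y \<partial>lborel)"
      unfolding x by (subst emeasure_density) (auto intro!: nn_integral_cong split: split_indicator)
    also have "\<dots> = (if x < 0 then 0 else ennreal (4 / 3 * pi * (sinh x) ^ 3))"
    proof (cases "x < 0")
      case False
      have "(\<integral>\<^sup>+y. ennreal (4 * pi * (sinh y)\<^sup>2 * cosh y) * indicator {0..x} y \<partial>lborel) =
          ennreal (4 / 3 * pi * (sinh x) ^ 3 - 4 / 3 * pi * (sinh 0) ^ 3)"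
        using False by (intro nn_integral_FTC_Icc) (auto intro!: derivative_eq_intros)
      then show ?thesis using False by simp
    qed simp
    finally show ?thesis unfolding x M by simp
  qed
  show "Int_stable ?E" by (auto simp: Int_stable_def)
  show "sets ?M = sigma_sets UNIV ?E" "sets ?N = sigma_sets UNIV ?E"
    by (simp_all add: borel_eq_atMost)
  show "range (\<lambda>n. {..real n}) \<subseteq> ?E" by auto
  show "(\<Union>n. {..real n}) = UNIV" using real_arch_simple by auto
  show "emeasure ?M {..real n} \<noteq> \<infinity>" for n by (simp add: M)
qed simp

lemma q0_pos: "0 < q0 q" and q0_ge_1: "1 \<le> q0 q" and q0_power2: "(q0 q)\<^sup>2 = 1 + (norm q)\<^sup>2"
  by (simp_all add: q0_def add_pos_nonneg)

lemma q0_measurable [measurable]: "q0 \<in> borel_measurable borel"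
  unfolding q0_def by measurable

lemma cosh_arsinh_norm: "cosh (arsinh (norm p)) = q0 p"
  by (simp add: cosh_arsinh_real q0_def add.commute)

lemma
  fixes g :: "real \<Rightarrow> real"
  assumes [measurable]: "g \<in> borel_measurable borel"
  shows integrable_q0_iff: "integrable lborel (\<lambda>p. g (q0 p)) \<longleftrightarrow>
      set_integrable lborel {0..} (\<lambda>x. 4 * pi * (sinh x)\<^sup>2 * cosh x * g (cosh x))"
    and integral_q0: "(\<integral>p. g (q0 p) \<partial>lborel) =
      (LBINT x:{0..}. 4 * pi * (sinh x)\<^sup>2 * cosh x * g (cosh x))"
proof -
  define w :: "real \<Rightarrow> real" where "w x = 4 * pi * (sinh x)\<^sup>2 * cosh x * indicator {0..} x" for x
  have [measurable]: "w \<in> borel_measurable borel" unfolding w_def by measurable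
  have w0: "AE x in lborel. 0 \<le> w x" by (simp add: w_def)
  have *: "distr lborel borel (\<lambda>p::real^3. arsinh (norm p)) = density lborel (\<lambda>x. ennreal (w x))"
    unfolding distr_lborel_rapidity w_def
    by (intro arg_cong[where f="density lborel"] ext) (simp split: split_indicator)
  have eq: "(\<lambda>x. w x *\<^sub>R g (cosh x)) =
      (\<lambda>x. indicator {0..} x *\<^sub>R (4 * pi * (sinh x)\<^sup>2 * cosh x * g (cosh x)))"
    by (auto simp: w_def split: split_indicator)
  have "integrable lborel (\<lambda>p. g (q0 p)) \<longleftrightarrow>
      integrable (distr lborel borel (\<lambda>p::real^3. arsinh (norm p))) (\<lambda>x. g (cosh x))"
    by (subst integrable_distr_eq) (auto simp: cosh_arsinh_norm)
  also have "\<dots> \<longleftrightarrow> integrable lborel (\<lambda>x. w x *\<^sub>R g (cosh x))"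
    unfolding * by (rule integrable_density) (use w0 in auto)
  finally show "integrable lborel (\<lambda>p. g (q0 p)) \<longleftrightarrow>
      set_integrable lborel {0..} (\<lambda>x. 4 * pi * (sinh x)\<^sup>2 * cosh x * g (cosh x))"
    unfolding set_integrable_def eq .
  have "(\<integral>p. g (q0 p) \<partial>lborel) =
      (\<integral>x. g (cosh x) \<partial>distr lborel borel (\<lambda>p::real^3. arsinh (norm p)))"
    by (subst integral_distr) (auto simp: cosh_arsinh_norm)
  also have "\<dots> = (\<integral>x. w x *\<^sub>R g (cosh x) \<partial>lborel)"
    unfolding * by (rule integral_density) (use w0 in auto)
  finally show "(\<integral>p. g (q0 p) \<partial>lborel) =
      (LBINT x:{0..}. 4 * pi * (sinh x)\<^sup>2 * cosh x * g (cosh x))"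
    unfolding set_lebesgue_integral_def eq .
qed

section \<open>Integrals against \<open>exp (- \<beta> * cosh x)\<close>\<close>

text \<open>Keep the single term \<open>u ^ 6 / fact 6\<close> of the exponential series, with
  \<open>u = \<beta> * exp x / 2\<close> below \<open>\<beta> * cosh x\<close>. The power 6 is one
  more than the highest power of \<open>cosh x\<close> met in the integrands, so one factor
  \<open>exp (- x)\<close> remains.\<close>

lemma exp_minus_cosh_le:
  fixes \<beta> x :: real
  assumes "\<beta> > 0"
  shows "exp (- \<beta> * cosh x) \<le> fact 6 * (2 / \<beta>) ^ 6 * exp (- x) ^ 6"
proof -
  define u where "u = \<beta> * exp x / 2"
  have u: "u > 0" using assms by (simp add: u_def)
  have "u ^ 6 / fact 6 \<le> exp u"
  proof -
    have "sum (\<lambda>n. u ^ n /\<^sub>R fact n) {6} \<le> suminf (\<lambda>n. u ^ n /\<^sub>R fact n)"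
      using u by (intro sum_le_suminf summable_exp_generic) auto
    then show ?thesis by (simp add: exp_def divide_inverse mult.commute)
  qed
  also have "u \<le> \<beta> * cosh x"
    using assms by (simp add: u_def cosh_field_def)
  finally have "u ^ 6 / fact 6 \<le> exp (\<beta> * cosh x)" by simp
  then have "inverse (exp (\<beta> * cosh x)) \<le> inverse (u ^ 6 / fact 6)"
    using u by (intro le_imp_inverse_le) auto
  also have "\<dots> = fact 6 * (2 / \<beta>) ^ 6 * exp (- x) ^ 6"
    by (simp add: u_def power_divide power_mult_distrib exp_minus field_simps)
  finally show ?thesis by (simp add: exp_minus)
qed

lemma
  fixes \<beta> K :: real and g :: "real \<Rightarrow> real"
  assumes \<beta>: "\<beta> > 0" and g: "\<And>x. 0 \<le> x \<Longrightarrow> \<bar>g x\<bar> \<le> K * cosh x ^ 5" and K: "K \<ge> 0"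
    and [measurable]: "g \<in> borel_measurable borel"
  shows set_integrable_exp_cosh: "set_integrable lborel {0..} (\<lambda>x. g x * exp (- \<beta> * cosh x))"
    and tendsto_exp_cosh: "((\<lambda>x. g x * exp (- \<beta> * cosh x)) \<longlongrightarrow> 0) at_top"
proof -
  define K' where "K' = K * (fact 6 * (2 / \<beta>) ^ 6)"
  have le: "\<bar>g x * exp (- \<beta> * cosh x)\<bar> \<le> K' * exp (- x)" if x: "0 \<le> x" for x
  proof -
    have "cosh x \<le> exp x" using x by (simp add: cosh_field_def)
    then have "cosh x ^ 5 \<le> exp x ^ 5" by (intro power_mono) auto
    then have "\<bar>g x\<bar> \<le> K * exp x ^ 5" using g[OF x] K by (meson mult_left_mono order_trans)
    then have "\<bar>g x * exp (- \<beta> * cosh x)\<bar> \<le> (K * exp x ^ 5) * (fact 6 * (2 / \<beta>) ^ 6 * exp (- x) ^ 6)"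
      unfolding abs_mult using exp_minus_cosh_le[OF \<beta>, of x] by (intro mult_mono) auto
    also have "\<dots> = K' * ((exp x * exp (- x)) ^ 5 * exp (- x))"
      unfolding K'_def power_mult_distrib by (simp add: eval_nat_numeral)
    also have "\<dots> = K' * exp (- x)" by (simp add: exp_minus)
    finally show ?thesis .
  qed
  have lim: "((\<lambda>x::real. exp (- x)) \<longlongrightarrow> 0) at_top"
    by (intro filterlim_compose[OF exp_at_bot] filterlim_uminus_at_bot_at_top)
  have "(\<integral>\<^sup>+x. ennreal (exp (- x)) * indicator {0..} x \<partial>lborel) = ennreal (0 - (- exp (- 0)))"
  proof (rule nn_integral_FTC_atLeast)
    show "((\<lambda>x::real. - exp (- x)) \<longlongrightarrow> 0) at_top" using tendsto_minus[OF lim] by simp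
  qed (auto intro!: derivative_eq_intros)
  moreover have "(\<integral>\<^sup>+x. ennreal (norm (indicator {0..} x *\<^sub>R exp (- x :: real))) \<partial>lborel) =
      (\<integral>\<^sup>+x. ennreal (exp (- x)) * indicator {0..} x \<partial>lborel)"
    by (intro nn_integral_cong) (simp split: split_indicator)
  ultimately have "set_integrable lborel {0..} (\<lambda>x::real. exp (- x))"
    unfolding set_integrable_def by (intro integrableI_bounded) auto
  then have "set_integrable lborel {0..} (\<lambda>x. K' * exp (- x))" by (rule set_integrable_mult_right)
  then show "set_integrable lborel {0..} (\<lambda>x. g x * exp (- \<beta> * cosh x))"
  proof (rule set_integrable_bound)
    show "AE x in lborel. x \<in> {0..} \<longrightarrow> norm (g x * exp (- \<beta> * cosh x)) \<le> norm (K' * exp (- x))"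
    proof (intro AE_I2 impI)
      fix x :: real assume "x \<in> {0..}"
      then have "norm (g x * exp (- \<beta> * cosh x)) \<le> K' * exp (- x)" using le[of x] by simp
      also have "\<dots> \<le> norm (K' * exp (- x))" by simp
      finally show "norm (g x * exp (- \<beta> * cosh x)) \<le> norm (K' * exp (- x))" .
    qed
  qed (simp add: set_borel_measurable_def)
  have "((\<lambda>x. K' * exp (- x)) \<longlongrightarrow> K' * 0) at_top" by (intro tendsto_intros lim)
  then have lim': "((\<lambda>x. K' * exp (- x)) \<longlongrightarrow> 0) at_top" by simp
  have "\<forall>\<^sub>F x in at_top. norm (g x * exp (- \<beta> * cosh x)) \<le> K' * exp (- x)"
    using eventually_ge_at_top[of 0] by eventually_elim (simp only: real_norm_def le)
  from Lim_null_comparison[OF this lim']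
  show "((\<lambda>x. g x * exp (- \<beta> * cosh x)) \<longlongrightarrow> 0) at_top" .
qed

text \<open>The boundary term vanishes at 0 by \<open>g 0 = 0\<close> and at infinity by decay. The
  growth of \<open>g\<close> is limited to degree 4 because the derivative of the exponential
  supplies a factor \<open>sinh x\<close>, which raises it to the 5 of
  \<open>set_integrable_exp_cosh\<close>.\<close>

lemma exp_cosh_by_parts:
  fixes \<beta> K :: real and g g' :: "real \<Rightarrow> real"
  assumes \<beta>: "\<beta> > 0" and g0: "g 0 = 0" and g: "\<And>x. (g has_real_derivative g' x) (at x)"
    and cont: "continuous_on UNIV g'"
    and bounds: "\<And>x. 0 \<le> x \<Longrightarrow> \<bar>g x\<bar> \<le> K * cosh x ^ 4" "\<And>x. 0 \<le> x \<Longrightarrow> \<bar>g' x\<bar> \<le> K * cosh x ^ 4" and K: "K \<ge> 0"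
  shows "(LBINT x:{0..}. g' x * exp (- \<beta> * cosh x)) = \<beta> * (LBINT x:{0..}. g x * sinh x * exp (- \<beta> * cosh x))"
proof -
  have contg: "continuous_on UNIV g" using g by (meson DERIV_isCont continuous_at_imp_continuous_on)
  have [measurable]: "g \<in> borel_measurable borel" "g' \<in> borel_measurable borel"
    using cont contg by (auto intro: borel_measurable_continuous_onI)
  have p45: "K * cosh x ^ 4 \<le> K * cosh x ^ 5" for x :: real
    using K cosh_real_ge_1[of x] by (intro mult_left_mono power_increasing) auto
  have b1: "\<bar>g x\<bar> \<le> K * cosh x ^ 5" "\<bar>g' x\<bar> \<le> K * cosh x ^ 5" if "0 \<le> x" for x
    using bounds[OF that] p45[of x] by linarith+
  have b2: "\<bar>g x * sinh x\<bar> \<le> K * cosh x ^ 5" if x: "0 \<le> x" for x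
  proof -
    have "\<bar>g x * sinh x\<bar> \<le> (K * cosh x ^ 4) * cosh x"
      unfolding abs_mult using bounds(1)[OF x] x sinh_le_cosh_real[of x] by (intro mult_mono) auto
    then show ?thesis by (simp add: eval_nat_numeral mult_ac)
  qed
  note i1 = set_integrable_exp_cosh[of \<beta> g' K, OF \<beta> b1(2) K]
  note i2 = set_integrable_exp_cosh[of \<beta> "\<lambda>x. g x * sinh x" K, OF \<beta> b2 K]
  define F where "F x = g x * exp (- \<beta> * cosh x)" for x
  define f where "f x = g' x * exp (- \<beta> * cosh x) - \<beta> * (g x * sinh x * exp (- \<beta> * cosh x))" for x
  have i: "set_integrable lborel {0..} f"
    unfolding f_def using i1 i2 by (intro set_integral_diff set_integrable_mult_right) auto
  \<comment> \<open>The fundamental theorem is applied on bounded intervals, where the integral is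
    \<open>F (real n)\<close> because \<open>F 0 = 0\<close>; dominated convergence then removes the
    bound.\<close>
  have "(\<lambda>n. \<integral>x. indicator {0..real n} x *\<^sub>R f x \<partial>lborel) \<longlonglongrightarrow> (\<integral>x. indicator {0..} x *\<^sub>R f x \<partial>lborel)"
  proof (rule integral_dominated_convergence)
    show "integrable lborel (\<lambda>x. norm (indicator {0..} x *\<^sub>R f x))"
      using i unfolding set_integrable_def by (rule integrable_norm)
    show "AE x in lborel. (\<lambda>n. indicator {0..real n} x *\<^sub>R f x) \<longlonglongrightarrow> indicator {0..} x *\<^sub>R f x"
    proof (rule AE_I2)
      fix x :: real
      obtain N where "x \<le> real N" using real_arch_simple by blast
      then have "\<forall>n\<ge>N. indicator {0..real n} x *\<^sub>R f x = indicator {0..} x *\<^sub>R f x"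
        by (auto split: split_indicator)
      then show "(\<lambda>n. indicator {0..real n} x *\<^sub>R f x) \<longlonglongrightarrow> indicator {0..} x *\<^sub>R f x"
        by (intro tendsto_eventually) (auto simp: eventually_sequentially)
    qed
    show "AE x in lborel. norm (indicator {0..real n} x *\<^sub>R f x) \<le> norm (indicator {0..} x *\<^sub>R f x)" for n
      by (intro AE_I2) (simp split: split_indicator)
  qed (auto simp: f_def)
  moreover have "(\<integral>x. indicator {0..real n} x *\<^sub>R f x \<partial>lborel) = F (real n)" for n
  proof -
    have "(\<integral>x. indicator {0..real n} x *\<^sub>R f x \<partial>lborel) = F (real n) - F 0"
    proof (rule integral_FTC_atLeastAtMost)
      show "(F has_vector_derivative f x) (at x within {0..real n})" for x
        unfolding F_def f_def has_real_derivative_iff_has_vector_derivative[symmetric]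
        by (rule has_field_derivative_at_within)
          (auto intro!: derivative_eq_intros g simp: algebra_simps)
      show "continuous_on {0..real n} f"
        unfolding f_def
        by (intro continuous_intros continuous_on_subset[OF cont] continuous_on_subset[OF contg]) auto
    qed simp
    then show ?thesis by (simp add: F_def g0)
  qed
  moreover have "(\<lambda>n. F (real n)) \<longlonglongrightarrow> 0"
    unfolding F_def
    by (rule filterlim_compose[OF tendsto_exp_cosh[of \<beta> g K, OF \<beta> b1(1) K] filterlim_real_sequentially]) auto
  ultimately have "(LBINT x:{0..}. f x) = 0"
    unfolding set_lebesgue_integral_def using LIMSEQ_unique by fastforce
  then show ?thesis
    unfolding f_def using i1 i2 by (simp add: set_integral_diff)
qed

section \<open>Reflections and permutations of coordinates\<close>

lemma integral_orthogonal_transformation: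
  fixes f :: "real^3 \<Rightarrow> real^3" and h :: "real^3 \<Rightarrow> real"
  assumes f: "orthogonal_transformation f" and [measurable]: "h \<in> borel_measurable borel"
  shows "(\<integral>p. h (f p) \<partial>lborel) = (\<integral>p. h p \<partial>lborel)"
proof -
  have [measurable]: "f \<in> borel_measurable borel"
    using f by (intro borel_measurable_continuous_onI linear_continuous_on linear_linear[THEN iffD2])
      (simp add: orthogonal_transformation_def)
  have "(\<integral>p. h (f p) \<partial>lborel) = (\<integral>p. h p \<partial>distr lborel borel f)"
    by (subst integral_distr) auto
  then show ?thesis by (simp add: distr_lborel_orthogonal_transformation[OF f])
qed

text \<open>Reflecting one coordinate preserves the measure and negates the integrand, so the
  integral equals its own negative.\<close>

lemma integral_odd_coordinate:
  fixes h :: "real^3 \<Rightarrow> real" and i :: 3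
  assumes h: "h \<in> borel_measurable borel"
    and odd: "\<And>p. h (\<chi> j. if j = i then - p $ j else p $ j) = - h p"
  shows "(\<integral>p. h p \<partial>lborel) = 0"
proof -
  define f :: "real^3 \<Rightarrow> real^3" where "f p = (\<chi> j. if j = i then - p $ j else p $ j)" for p
  have "linear f" unfolding f_def by (rule linearI) (auto simp: vec_eq_iff)
  moreover have "norm (f p) = norm p" for p
    unfolding f_def norm_eq_sqrt_inner inner_vec_def by (intro arg_cong[where f=sqrt] sum.cong) auto
  ultimately have "orthogonal_transformation f" by (simp add: orthogonal_transformation)
  from integral_orthogonal_transformation[OF this h]
  show ?thesis using odd by (simp add: f_def)
qed

lemma integral_swap_coordinates:
  fixes h :: "real^3 \<Rightarrow> real" and i j :: 3
  assumes h: "h \<in> borel_measurable borel"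
  shows "(\<integral>p. h (\<chi> k. p $ Transposition.transpose i j k) \<partial>lborel) = (\<integral>p. h p \<partial>lborel)"
proof -
  define f :: "real^3 \<Rightarrow> real^3" where "f p = (\<chi> k. p $ Transposition.transpose i j k)" for p
  have "linear f" unfolding f_def by (rule linearI) (auto simp: vec_eq_iff)
  moreover have "norm (f p) = norm p" for p
    unfolding f_def norm_eq_sqrt_inner inner_vec_def
    using sum.reindex_bij_betw[of "Transposition.transpose i j" UNIV UNIV "\<lambda>k. p $ k \<bullet> p $ k"] by simp
  ultimately have "orthogonal_transformation f" by (simp add: orthogonal_transformation)
  from integral_orthogonal_transformation[OF this h] show ?thesis by (simp add: f_def)
qed

lemma norm_swap_coordinates: "norm (\<chi> k. p $ Transposition.transpose i j k) = norm (p :: real^3)"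
  unfolding norm_eq_sqrt_inner inner_vec_def
  using sum.reindex_bij_betw[of "Transposition.transpose i j" UNIV UNIV "\<lambda>k. p $ k \<bullet> p $ k"] by simp

lemma norm_flip_coordinate: "norm (\<chi> j. if j = i then - p $ j else p $ j) = norm (p :: real^3)"
  unfolding norm_eq_sqrt_inner inner_vec_def by (intro arg_cong[where f=sqrt] sum.cong) auto

lemma q0_swap [simp]: "q0 (\<chi> k. p $ Transposition.transpose i j k) = q0 p"
  by (simp add: q0_def norm_swap_coordinates)

lemma q0_flip [simp]: "q0 (\<chi> j. if j = i then - p $ j else p $ j) = q0 p"
  by (simp add: q0_def norm_flip_coordinate)

lemma norm_le_q0: "norm q \<le> q0 q"
  unfolding q0_def by (intro real_le_rsqrt) simp

lemma component_le_q0: "\<bar>q $ i\<bar> \<le> q0 q"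
  using component_le_norm_cart[of q i] norm_le_q0[of q] by linarith

lemma coordinate_measurable [measurable]: "(\<lambda>q :: real^3. q $ i) \<in> borel_measurable borel"
  by (intro borel_measurable_continuous_onI continuous_intros)

lemma abs_sinh_le_cosh: "\<bar>sinh x\<bar> \<le> cosh x" for x :: real
  using sinh_le_cosh_real[of "\<bar>x\<bar>"] by simp

lemma sinh_power2_le: "(sinh x)\<^sup>2 \<le> (cosh x)\<^sup>2" for x :: real
  by (simp add: cosh_square_eq)

lemma sum_bool_plus: "(\<Sum>k\<in>UNIV. f k) = f (Inl True) + f (Inl False) + (\<Sum>i\<in>UNIV. f (Inr i))"
  for f :: "bool + 'a::finite \<Rightarrow> 'b::comm_monoid_add"
  unfolding UNIV_Plus_UNIV[symmetric] by (subst sum.Plus) (auto simp: UNIV_bool ac_simps)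

lemma inner_mult_of_real: "w \<bullet> (c * complex_of_real r) = c \<bullet> (w * complex_of_real r)"
  by (simp add: inner_complex_def algebra_simps)

lemma J0_measurable [measurable]: "J0 \<beta> \<in> borel_measurable borel"
  unfolding J0_def by measurable

context
  fixes \<beta> :: real
  assumes \<beta>: "\<beta> > 0"
begin

text \<open>In rapidity coordinates the bound gains \<open>(sinh x)\<^sup>2 * cosh x\<close> and
  reaches degree 5 in \<open>cosh x\<close>, exactly what \<open>set_integrable_exp_cosh\<close>
  admits.\<close>

lemma integrable_dominated:
  fixes h :: "real^3 \<Rightarrow> real"
  assumes h: "h \<in> borel_measurable borel" and le: "\<And>q. \<bar>h q\<bar> \<le> (q0 q)\<^sup>2 * exp (- \<beta> * q0 q)"
  shows "integrable lborel h"
proof -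
  have "set_integrable lborel {0..} (\<lambda>x. (4 * pi * (sinh x)\<^sup>2 * cosh x * (cosh x)\<^sup>2) * exp (- \<beta> * cosh x))"
  proof (rule set_integrable_exp_cosh[OF \<beta>, where K="4 * pi"])
    fix x :: real
    have "4 * pi * (sinh x)\<^sup>2 * cosh x * (cosh x)\<^sup>2 \<le> 4 * pi * (cosh x)\<^sup>2 * cosh x * (cosh x)\<^sup>2"
      by (intro mult_right_mono mult_left_mono sinh_power2_le) auto
    then show "\<bar>4 * pi * (sinh x)\<^sup>2 * cosh x * (cosh x)\<^sup>2\<bar> \<le> 4 * pi * cosh x ^ 5"
      by (simp add: eval_nat_numeral mult_ac)
  qed auto
  then have "integrable lborel (\<lambda>q. (q0 q)\<^sup>2 * exp (- \<beta> * q0 q))"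
    by (subst integrable_q0_iff[of "\<lambda>y. y\<^sup>2 * exp (- \<beta> * y)"]) (simp_all add: mult.assoc)
  then show ?thesis
  proof (rule Bochner_Integration.integrable_bound)
    show "AE q in lborel. norm (h q) \<le> norm ((q0 q)\<^sup>2 * exp (- \<beta> * q0 q))"
      using le by (intro AE_I2) simp
  qed (simp add: h)
qed

section \<open>Bessel functions as hyperbolic moments\<close>

text \<open>Integration by parts with \<open>g = sinh\<close> trades the kernel
  \<open>cosh x\<close> for the factor \<open>(sinh x)\<^sup>2\<close> of the volume
  element.\<close>

lemma Kbes_1_eq: "Kbes 1 \<beta> = \<beta> * (LBINT x:{0..}. (sinh x)\<^sup>2 * exp (- \<beta> * cosh x))"
proof -
  have 1: "cosh x \<le> cosh x ^ 4" for x :: real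
    using power_increasing[of 1 4 "cosh x"] cosh_real_ge_1[of x] by simp
  have "(LBINT x:{0..}. cosh x * exp (- \<beta> * cosh x)) = \<beta> * (LBINT x:{0..}. sinh x * sinh x * exp (- \<beta> * cosh x))"
  proof (rule exp_cosh_by_parts[where K=1])
    show "\<bar>sinh x\<bar> \<le> 1 * cosh x ^ 4" "\<bar>cosh x\<bar> \<le> 1 * cosh x ^ 4" for x :: real
      using abs_sinh_le_cosh[of x] 1[of x] by simp_all
  qed (use \<beta> in \<open>auto intro!: derivative_eq_intros continuous_intros\<close>)
  then show ?thesis by (simp add: Kbes_def power2_eq_square)
qed

text \<open>The choice is \<open>g x = sinh x * cosh x\<close>, whose derivative is the kernel
  \<open>cosh (2 * x)\<close> of order 2.\<close>

lemma Kbes_2_eq: "Kbes 2 \<beta> = \<beta> * (LBINT x:{0..}. (sinh x)\<^sup>2 * cosh x * exp (- \<beta> * cosh x))"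
proof -
  have 1: "cosh x ^ 2 \<le> cosh x ^ 4" for x :: real
    using power_increasing[of 2 4 "cosh x"] cosh_real_ge_1[of x] by simp
  have 2: "\<bar>sinh x * cosh x\<bar> \<le> cosh x ^ 2" for x :: real
    unfolding abs_mult power2_eq_square using abs_sinh_le_cosh[of x] by (intro mult_mono) auto
  have "(LBINT x:{0..}. cosh (2 * x) * exp (- \<beta> * cosh x)) =
      \<beta> * (LBINT x:{0..}. (sinh x * cosh x) * sinh x * exp (- \<beta> * cosh x))"
  proof (rule exp_cosh_by_parts[where K=2])
    fix x :: real
    show "((\<lambda>x. sinh x * cosh x) has_real_derivative cosh (2 * x)) (at x)"
      by (auto intro!: derivative_eq_intros simp: cosh_double power2_eq_square)
    show "\<bar>sinh x * cosh x\<bar> \<le> 2 * cosh x ^ 4" using 1[of x] 2[of x] zero_le_power2[of "cosh x"] by linarith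
    show "\<bar>cosh (2 * x)\<bar> \<le> 2 * cosh x ^ 4"
      using 1[of x] sinh_power2_le[of x] zero_le_power2[of "sinh x"] zero_le_power2[of "cosh x"]
      unfolding cosh_double by linarith
  qed (use \<beta> in \<open>auto intro!: continuous_intros\<close>)
  then show ?thesis by (simp add: Kbes_def power2_eq_square mult_ac)
qed

text \<open>The function \<open>sinh x * (cosh x)\<^sup>2\<close> has derivative
  \<open>cosh x + 3 * ((sinh x)\<^sup>2 * cosh x)\<close>. The first summand is the kernel of
  \<open>Kbes 1\<close>, the second the integrand of \<open>Mnorm\<close> up to a constant; its
  factor 3 is the origin of \<open>3 / \<beta>\<close> in \<open>Psi\<close>.\<close>

lemma third_moment_eq: "\<beta> * (LBINT x:{0..}. (sinh x)\<^sup>2 * (cosh x)\<^sup>2 * exp (- \<beta> * cosh x)) =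
  Kbes 1 \<beta> + 3 * (LBINT x:{0..}. (sinh x)\<^sup>2 * cosh x * exp (- \<beta> * cosh x))"
proof -
  have 1: "cosh x ^ 3 \<le> cosh x ^ 4" "cosh x \<le> cosh x ^ 4" "cosh x \<le> cosh x ^ 5" "cosh x ^ 3 \<le> cosh x ^ 5" for x :: real
    using power_increasing[of 3 4 "cosh x"] power_increasing[of 1 4 "cosh x"]
     power_increasing[of 1 5 "cosh x"] power_increasing[of 3 5 "cosh x"] cosh_real_ge_1[of x] by simp_all
  have 2: "\<bar>sinh x * (cosh x)\<^sup>2\<bar> \<le> cosh x ^ 3" for x :: real
    using mult_right_mono[OF abs_sinh_le_cosh[of x], of "(cosh x)\<^sup>2"]
    by (simp add: abs_mult eval_nat_numeral)
  have 3: "0 \<le> (sinh x)\<^sup>2 * cosh x" "(sinh x)\<^sup>2 * cosh x \<le> cosh x ^ 3" for x :: real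
    using mult_right_mono[OF sinh_power2_le[of x], of "cosh x"] by (simp_all add: eval_nat_numeral)
  have "(LBINT x:{0..}. (cosh x + 3 * ((sinh x)\<^sup>2 * cosh x)) * exp (- \<beta> * cosh x)) =
      \<beta> * (LBINT x:{0..}. (sinh x * (cosh x)\<^sup>2) * sinh x * exp (- \<beta> * cosh x))"
  proof (rule exp_cosh_by_parts[where K=4])
    fix x :: real
    have "cosh x ^ 3 = cosh x * (sinh x)\<^sup>2 + cosh x"
      using cosh_square_eq[of x] by (simp add: power3_eq_cube power2_eq_square algebra_simps)
    then show "((\<lambda>x. sinh x * (cosh x)\<^sup>2) has_real_derivative cosh x + 3 * ((sinh x)\<^sup>2 * cosh x)) (at x)"
      by (auto intro!: derivative_eq_intros simp: power3_eq_cube power2_eq_square algebra_simps)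
    show "\<bar>sinh x * (cosh x)\<^sup>2\<bar> \<le> 4 * cosh x ^ 4"
      using 1(1)[of x] 2[of x] zero_le_power[of "cosh x" 4] cosh_real_nonneg[of x] by linarith
    show "\<bar>cosh x + 3 * ((sinh x)\<^sup>2 * cosh x)\<bar> \<le> 4 * cosh x ^ 4"
      using 1(1,2)[of x] 3[of x] cosh_real_nonneg[of x] by linarith
  qed (use \<beta> in \<open>auto intro!: continuous_intros\<close>)
  moreover have "set_integrable lborel {0..} (\<lambda>x. cosh x * exp (- \<beta> * cosh x))"
    by (rule set_integrable_exp_cosh[OF \<beta>, where K=1]) (use 1(3) in auto)
  moreover have "set_integrable lborel {0..} (\<lambda>x. ((sinh x)\<^sup>2 * cosh x) * exp (- \<beta> * cosh x))"
  proof (rule set_integrable_exp_cosh[OF \<beta>, where K=1])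
    show "\<bar>(sinh x)\<^sup>2 * cosh x\<bar> \<le> 1 * cosh x ^ 5" for x :: real
      using 3[of x] 1(4)[of x] by linarith
  qed auto
  ultimately have "\<beta> * (LBINT x:{0..}. (sinh x * (cosh x)\<^sup>2) * sinh x * exp (- \<beta> * cosh x)) =
      (LBINT x:{0..}. cosh x * exp (- \<beta> * cosh x)) +
      (LBINT x:{0..}. 3 * (((sinh x)\<^sup>2 * cosh x) * exp (- \<beta> * cosh x)))"
    by (subst set_integral_add(2)[symmetric]) (simp_all add: distrib_right mult.assoc)
  also have "(LBINT x:{0..}. (sinh x * (cosh x)\<^sup>2) * sinh x * exp (- \<beta> * cosh x)) =
      (LBINT x:{0..}. (sinh x)\<^sup>2 * (cosh x)\<^sup>2 * exp (- \<beta> * cosh x))"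
    by (simp add: power2_eq_square mult_ac)
  finally show ?thesis by (simp add: Kbes_def)
qed

lemma integral_exp_over_q0: "(\<integral>p. exp (- \<beta> * q0 p) / q0 p \<partial>lborel) = 4 * pi / \<beta> * Kbes 1 \<beta>"
proof -
  have "(\<integral>p. exp (- \<beta> * q0 p) / q0 p \<partial>lborel) =
      (LBINT x:{0..}. 4 * pi * (sinh x)\<^sup>2 * cosh x * (exp (- \<beta> * cosh x) / cosh x))"
    by (rule integral_q0[of "\<lambda>y. exp (- \<beta> * y) / y"]) measurable
  also have "\<dots> = (LBINT x:{0..}. (4 * pi) * ((sinh x)\<^sup>2 * exp (- \<beta> * cosh x)))"
    by simp
  also have "\<dots> = 4 * pi / \<beta> * Kbes 1 \<beta>"
    unfolding set_integral_mult_right Kbes_1_eq using \<beta> by simp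
  finally show ?thesis .
qed

lemma Mnorm_eq: "Mnorm \<beta> = 4 * pi / \<beta> * Kbes 2 \<beta>"
proof -
  have "Mnorm \<beta> = (LBINT x:{0..}. 4 * pi * (sinh x)\<^sup>2 * cosh x * exp (- \<beta> * cosh x))"
    unfolding Mnorm_def by (rule integral_q0[of "\<lambda>y. exp (- \<beta> * y)"]) measurable
  also have "\<dots> = (LBINT x:{0..}. (4 * pi) * ((sinh x)\<^sup>2 * cosh x * exp (- \<beta> * cosh x)))"
    by (simp add: mult.assoc)
  also have "\<dots> = 4 * pi / \<beta> * Kbes 2 \<beta>"
    unfolding set_integral_mult_right Kbes_2_eq using \<beta> by simp
  finally show ?thesis .
qed

lemma integral_q0_exp: "(\<integral>p. q0 p * exp (- \<beta> * q0 p) \<partial>lborel) =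
  3 / \<beta> * Mnorm \<beta> + (\<integral>p. exp (- \<beta> * q0 p) / q0 p \<partial>lborel)"
proof -
  have "(\<integral>p. q0 p * exp (- \<beta> * q0 p) \<partial>lborel) =
      (LBINT x:{0..}. 4 * pi * (sinh x)\<^sup>2 * cosh x * (cosh x * exp (- \<beta> * cosh x)))"
    by (rule integral_q0[of "\<lambda>y. y * exp (- \<beta> * y)"]) measurable
  also have "\<dots> = (LBINT x:{0..}. (4 * pi) * ((sinh x)\<^sup>2 * (cosh x)\<^sup>2 * exp (- \<beta> * cosh x)))"
    by (simp add: power2_eq_square mult_ac)
  also have "\<dots> = 4 * pi / \<beta> * (\<beta> * (LBINT x:{0..}. (sinh x)\<^sup>2 * (cosh x)\<^sup>2 * exp (- \<beta> * cosh x)))"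
    unfolding set_integral_mult_right using \<beta> by simp
  also have "\<dots> = 3 / \<beta> * Mnorm \<beta> + (\<integral>p. exp (- \<beta> * q0 p) / q0 p \<partial>lborel)"
    unfolding third_moment_eq integral_exp_over_q0 Mnorm_eq Kbes_2_eq using \<beta> by (simp add: field_simps)
  finally show ?thesis .
qed

lemma Mnorm_pos: "Mnorm \<beta> > 0"
proof -
  have i: "integrable lborel (\<lambda>p. exp (- \<beta> * q0 p))"
    by (rule integrable_dominated) (use power_mono[OF q0_ge_1, of 2] in auto)
  have "Mnorm \<beta> \<noteq> 0"
  proof
    assume "Mnorm \<beta> = 0"
    then have "AE p in lborel. exp (- \<beta> * q0 p) = (0::real)"
      using integral_nonneg_eq_0_iff_AE[OF i] by (simp add: Mnorm_def)
    then have "AE p :: real^3 in lborel. False" by simp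
    then show False by (simp add: AE_iff_null null_sets_def)
  qed
  moreover have "0 \<le> Mnorm \<beta>" unfolding Mnorm_def by simp
  ultimately show ?thesis by simp
qed

lemma Kbes_2_pos: "Kbes 2 \<beta> > 0"
  using Mnorm_pos \<beta> unfolding Mnorm_eq by (simp add: zero_less_divide_iff zero_less_mult_iff)

section \<open>Moments that enter the Gram matrix\<close>

abbreviation J where "J \<equiv> J0 \<beta>"

lemma J_nonneg: "0 \<le> J q"
  using Mnorm_pos by (simp add: J0_def)

lemma integrable_J_dominated:
  fixes h :: "real^3 \<Rightarrow> real"
  assumes h: "h \<in> borel_measurable borel" and le: "\<And>q. \<bar>h q\<bar> \<le> (q0 q)\<^sup>2"
  shows "integrable lborel (\<lambda>q. h q * J q)"
proof -
  have "integrable lborel (\<lambda>q. h q * exp (- \<beta> * q0 q))"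
    by (rule integrable_dominated) (use h le in \<open>auto simp: abs_mult\<close>)
  then have "integrable lborel (\<lambda>q. h q * exp (- \<beta> * q0 q) / Mnorm \<beta>)" by (rule integrable_divide)
  then show ?thesis by (simp add: J0_def)
qed

lemma integral_J: "(\<integral>q. h q * J q \<partial>lborel) = (\<integral>q. h q * exp (- \<beta> * q0 q) \<partial>lborel) / Mnorm \<beta>"
  unfolding J0_def by simp

lemma moment_1_1: "(\<integral>q. 1 / q0 q * J q \<partial>lborel) = alpha0 \<beta>"
  unfolding integral_J using integral_exp_over_q0 \<beta> Mnorm_pos Kbes_2_pos
  by (simp add: alpha0_def Mnorm_eq)

lemma moment_0_1: "(\<integral>q. 1 * J q \<partial>lborel) = 1"
  unfolding integral_J using Mnorm_pos by (simp add: Mnorm_def)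

lemma moment_0_0: "(\<integral>q. q0 q * J q \<partial>lborel) = Psi \<beta>"
proof -
  have "(\<integral>q. q0 q * J q \<partial>lborel) = 3 / \<beta> + (\<integral>p. exp (- \<beta> * q0 p) / q0 p \<partial>lborel) / Mnorm \<beta>"
    unfolding integral_J integral_q0_exp using Mnorm_pos by (simp add: add_divide_distrib)
  also have "(\<integral>p. exp (- \<beta> * q0 p) / q0 p \<partial>lborel) / Mnorm \<beta> = alpha0 \<beta>"
    using moment_1_1 unfolding integral_J by simp
  finally show ?thesis by (simp add: Psi_def alpha0_def)
qed

lemma moment_odd:
  shows "(\<integral>q. q $ i * J q \<partial>lborel) = 0" and "(\<integral>q. q $ i / q0 q * J q \<partial>lborel) = 0"
    and "i \<noteq> j \<Longrightarrow> (\<integral>q. q $ i * q $ j / q0 q * J q \<partial>lborel) = 0"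
  by (rule integral_odd_coordinate[of _ i], measurable, simp add: J0_def)+

text \<open>Swapping coordinates shows that the three moments agree. Their sum integrates
  \<open>(norm q)\<^sup>2 / q0 q\<close>, which is \<open>q0 q - 1 / q0 q\<close>, and so equals
  \<open>Psi \<beta> - alpha0 \<beta>\<close>, that is \<open>3 / \<beta>\<close>.\<close>

lemma moment_coordinates: "(\<integral>q. q $ i * q $ i / q0 q * J q \<partial>lborel) = 1 / \<beta>"
proof -
  let ?I = "\<lambda>i. \<integral>q. q $ i * q $ i / q0 q * J q \<partial>lborel"
  have eq: "?I j = ?I i" for j :: 3
    using integral_swap_coordinates[of "\<lambda>q. q $ i * q $ i / q0 q * J q" i j] by (simp add: J0_def)
  have q0sq: "\<bar>q $ j * q $ j / q0 q\<bar> \<le> (q0 q)\<^sup>2" for q and j :: 3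
  proof -
    have "\<bar>q $ j * q $ j\<bar> \<le> q0 q * q0 q" unfolding abs_mult
      using component_le_q0[of q j] q0_pos[of q] by (intro mult_mono) auto
    also have "\<dots> \<le> (q0 q)\<^sup>2 * q0 q" using q0_ge_1[of q] by (simp add: power2_eq_square)
    finally show ?thesis using q0_pos[of q] by (simp add: divide_le_eq)
  qed
  have "(\<Sum>j::3\<in>UNIV. ?I j) = (\<Sum>j::3\<in>UNIV. ?I i)" by (intro sum.cong refl eq)
  then have "3 * ?I i = (\<Sum>j\<in>UNIV. ?I j)" by simp
  also have "\<dots> = (\<integral>q. (\<Sum>j\<in>UNIV. q $ j * q $ j / q0 q * J q) \<partial>lborel)"
    by (intro Bochner_Integration.integral_sum[symmetric] integrable_J_dominated q0sq) measurable
  also have "\<dots> = (\<integral>q. q0 q * J q - 1 / q0 q * J q \<partial>lborel)"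
  proof (intro Bochner_Integration.integral_cong refl)
    fix q :: "real^3"
    have "(\<Sum>j\<in>UNIV. q $ j * q $ j / q0 q * J q) = (norm q)\<^sup>2 / q0 q * J q"
      by (simp add: power2_norm_eq_inner inner_vec_def sum_divide_distrib sum_distrib_right)
    also have "(norm q)\<^sup>2 / q0 q = q0 q - 1 / q0 q"
      using q0_power2[of q] q0_pos[of q] by (simp add: field_simps power2_eq_square)
    finally show "(\<Sum>j\<in>UNIV. q $ j * q $ j / q0 q * J q) = q0 q * J q - 1 / q0 q * J q"
      by (simp add: algebra_simps)
  qed
  also have "\<dots> = Psi \<beta> - alpha0 \<beta>"
  proof -
    have "\<bar>q0 q\<bar> \<le> (q0 q)\<^sup>2" "\<bar>1 / q0 q\<bar> \<le> (q0 q)\<^sup>2" for q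
    proof -
      show "\<bar>q0 q\<bar> \<le> (q0 q)\<^sup>2" using q0_ge_1[of q] by (simp add: power2_eq_square)
      have "\<bar>1 / q0 q\<bar> \<le> 1" "1 \<le> (q0 q)\<^sup>2" using q0_ge_1[of q] by (simp_all add: one_le_power)
      then show "\<bar>1 / q0 q\<bar> \<le> (q0 q)\<^sup>2" by linarith
    qed
    then have "integrable lborel (\<lambda>q. q0 q * J q)" "integrable lborel (\<lambda>q. 1 / q0 q * J q)"
      by (intro integrable_J_dominated; simp)+
    then show ?thesis using moment_0_0 moment_1_1 by simp
  qed
  also have "\<dots> = 3 * (1 / \<beta>)" by (simp add: Psi_def alpha0_def)
  finally show ?thesis by simp
qed

section \<open>The linearized BGK operator\<close>

text \<open>The collision invariants: energy at \<open>Inl True\<close>, number at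
  \<open>Inl False\<close>, momentum at \<open>Inr i\<close>. A finite index type turns the
  projection into one sum over \<open>UNIV\<close>.\<close>

definition cinv :: "bool + 3 \<Rightarrow> real^3 \<Rightarrow> real" where
  "cinv k q = (case k of Inl b \<Rightarrow> if b then q0 q else 1 | Inr i \<Rightarrow> q $ i)"

definition \<phi> :: "bool + 3 \<Rightarrow> real^3 \<Rightarrow> real" where
  "\<phi> k q = cinv k q * sqrt (J q)"

definition \<psi> :: "bool + 3 \<Rightarrow> real^3 \<Rightarrow> real" where
  "\<psi> k q = \<phi> k q / q0 q"

definition mom :: "(real^3 \<Rightarrow> complex) \<Rightarrow> bool + 3 \<Rightarrow> complex" where
  "mom f k = (\<integral>q. f q * complex_of_real (\<psi> k q) \<partial>lborel)"

text \<open>For nonzero \<open>kappa0\<close> this is the inverse Gram matrix applied to the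
  moments: the block of energy and number has rows \<open>Psi\<close>, 1 and 1,
  \<open>alpha0\<close> with determinant \<open>kappa0\<close>, and each momentum has the entry
  \<open>1 / \<beta>\<close>.\<close>

definition coef :: "(real^3 \<Rightarrow> complex) \<Rightarrow> bool + 3 \<Rightarrow> complex" where
  "coef f k = (case k of
     Inl b \<Rightarrow> if b then complex_of_real (1 / kappa0 \<beta>) * (complex_of_real (alpha0 \<beta>) * mom f (Inl True) - mom f (Inl False))
       else complex_of_real (1 / kappa0 \<beta>) * (complex_of_real (Psi \<beta>) * mom f (Inl False) - mom f (Inl True))
   | Inr i \<Rightarrow> complex_of_real \<beta> * mom f (Inr i))"

definition gram :: "bool + 3 \<Rightarrow> bool + 3 \<Rightarrow> real" where
  "gram k l = (\<integral>q. cinv k q * cinv l q / q0 q * J q \<partial>lborel)"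

lemma cinv_measurable [measurable]: "cinv k \<in> borel_measurable borel"
  unfolding cinv_def by (cases k) auto

lemma \<phi>_measurable [measurable]: "\<phi> k \<in> borel_measurable borel"
  unfolding \<phi>_def by measurable

lemma \<psi>_measurable [measurable]: "\<psi> k \<in> borel_measurable borel"
  unfolding \<psi>_def by measurable

lemma cinv_le: "\<bar>cinv k q\<bar> \<le> q0 q"
  using q0_ge_1[of q] component_le_q0[of q] by (auto simp: cinv_def split: sum.split)

lemma \<phi>_L2: "(\<lambda>q. complex_of_real (\<phi> k q)) \<in> L2"
proof (rule L2I)
  have "integrable lborel (\<lambda>q. (cinv k q)\<^sup>2 * J q)"
  proof (rule integrable_J_dominated)
    show "\<bar>(cinv k q)\<^sup>2\<bar> \<le> (q0 q)\<^sup>2" for q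
      using power_mono[OF cinv_le[of k q], of 2] by simp
  qed measurable
  then show "integrable lborel (\<lambda>q. (cmod (complex_of_real (\<phi> k q)))\<^sup>2)"
    unfolding norm_of_real power2_abs by (simp add: \<phi>_def power_mult_distrib J_nonneg)
qed measurable

lemma \<psi>_L2: "(\<lambda>q. complex_of_real (\<psi> k q)) \<in> L2"
proof (rule L2_dominated(1)[OF _ \<phi>_L2[of k]])
  show "cmod (complex_of_real (\<psi> k q)) \<le> cmod (complex_of_real (\<phi> k q))" for q
    using q0_ge_1[of q] mult_left_mono[OF q0_ge_1[of q], of "\<bar>\<phi> k q\<bar>"]
    unfolding norm_of_real by (simp add: \<psi>_def abs_divide divide_le_eq)
qed measurable

lemma mom_integrable:
  assumes f: "f \<in> L2"
  shows "integrable lborel (\<lambda>q. f q * complex_of_real (\<psi> k q))"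
proof (rule Bochner_Integration.integrable_bound[OF L2_Cauchy_Schwarz(1)[OF f \<psi>_L2[of k]]])
  show "(\<lambda>q. f q * complex_of_real (\<psi> k q)) \<in> borel_measurable lborel"
    using L2_measurable[OF f] by measurable
qed (simp add: norm_mult)

lemma mom_lincomb:
  assumes "f \<in> L2" "g \<in> L2"
  shows "mom (\<lambda>q. b * f q + c * g q) k = b * mom f k + c * mom g k"
proof -
  have "mom (\<lambda>q. b * f q + c * g q) k =
      (\<integral>q. b * (f q * complex_of_real (\<psi> k q)) + c * (g q * complex_of_real (\<psi> k q)) \<partial>lborel)"
    by (simp add: mom_def algebra_simps)
  then show ?thesis
    using mom_integrable[OF assms(1), of k] mom_integrable[OF assms(2), of k] by (simp add: mom_def)
qed

text \<open>Cauchy-Schwarz against \<open>\<psi> k\<close>; summing over all indices makes the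
  constant independent of \<open>k\<close>.\<close>

lemma mom_bound:
  assumes f: "f \<in> L2"
  shows "cmod (mom f k) \<le> (\<Sum>l\<in>UNIV. L2norm (\<lambda>q. complex_of_real (\<psi> l q))) * L2norm f"
proof -
  have "cmod (mom f k) \<le> (\<integral>q. cmod (f q * complex_of_real (\<psi> k q)) \<partial>lborel)"
    unfolding mom_def by (rule integral_norm_bound)
  also have "\<dots> \<le> L2norm f * L2norm (\<lambda>q. complex_of_real (\<psi> k q))"
    unfolding norm_mult by (rule L2_Cauchy_Schwarz(2)[OF f \<psi>_L2])
  also have "\<dots> \<le> L2norm f * (\<Sum>l\<in>UNIV. L2norm (\<lambda>q. complex_of_real (\<psi> l q)))"
    by (intro mult_left_mono member_le_sum) auto
  finally show ?thesis by (simp add: mult.commute)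
qed

lemma coef_lincomb:
  assumes "f \<in> L2" "g \<in> L2"
  shows "coef (\<lambda>q. b * f q + c * g q) k = b * coef f k + c * coef g k"
  by (simp add: coef_def mom_lincomb[OF assms] algebra_simps split: sum.split)

lemma coef_bound: "\<exists>K\<ge>0. \<forall>f\<in>L2. \<forall>k. cmod (coef f k) \<le> K * L2norm f"
proof -
  define M where "M = (\<Sum>l\<in>UNIV. L2norm (\<lambda>q. complex_of_real (\<psi> l q)))"
  have M: "M \<ge> 0" unfolding M_def by (intro sum_nonneg) auto
  define D where "D = \<bar>1 / kappa0 \<beta>\<bar> * (\<bar>alpha0 \<beta>\<bar> + \<bar>Psi \<beta>\<bar> + 1) + \<bar>\<beta>\<bar>"
  have "cmod (coef f k) \<le> D * M * L2norm f" if f: "f \<in> L2" for f k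
  proof -
    define N where "N = M * L2norm f"
    have N: "N \<ge> 0" using M by (simp add: N_def)
    have m: "cmod (mom f k) \<le> N" for k using mom_bound[OF f] by (simp add: N_def M_def)
    have 1: "cmod (complex_of_real (1 / kappa0 \<beta>) * (complex_of_real s * mom f k - mom f l)) \<le> D * N"
      if s: "\<bar>s\<bar> \<le> \<bar>alpha0 \<beta>\<bar> + \<bar>Psi \<beta>\<bar>" for s k l
    proof -
      have "cmod (complex_of_real s * mom f k - mom f l) \<le> \<bar>s\<bar> * cmod (mom f k) + cmod (mom f l)"
        using norm_triangle_ineq4[of "complex_of_real s * mom f k" "mom f l"] by (simp add: norm_mult)
      also have "\<dots> \<le> (\<bar>alpha0 \<beta>\<bar> + \<bar>Psi \<beta>\<bar>) * N + N"
        using s m N by (intro add_mono mult_mono) auto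
      finally have "cmod (complex_of_real s * mom f k - mom f l) \<le> (\<bar>alpha0 \<beta>\<bar> + \<bar>Psi \<beta>\<bar> + 1) * N"
        by (simp add: algebra_simps)
      then have "cmod (complex_of_real (1 / kappa0 \<beta>) * (complex_of_real s * mom f k - mom f l)) \<le>
          \<bar>1 / kappa0 \<beta>\<bar> * ((\<bar>alpha0 \<beta>\<bar> + \<bar>Psi \<beta>\<bar> + 1) * N)"
        unfolding norm_mult norm_of_real by (rule mult_left_mono) simp
      also have "\<dots> \<le> D * N" using N by (simp add: D_def distrib_right mult.assoc)
      finally show ?thesis .
    qed
    have 2: "cmod (complex_of_real \<beta> * mom f k) \<le> D * N" for k
    proof -
      have "cmod (complex_of_real \<beta> * mom f k) \<le> \<bar>\<beta>\<bar> * N"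
        unfolding norm_mult norm_of_real by (intro mult_left_mono m) auto
      also have "\<dots> \<le> D * N" using N by (intro mult_right_mono) (auto simp: D_def)
      finally show ?thesis .
    qed
    have "cmod (coef f k) \<le> D * N"
      using 1[of "alpha0 \<beta>" "Inl True" "Inl False"] 1[of "Psi \<beta>" "Inl False" "Inl True"] 2
      unfolding coef_def by (auto split: sum.split)
    then show ?thesis by (simp add: N_def mult.assoc)
  qed
  moreover have "D * M \<ge> 0" using M by (simp add: D_def)
  ultimately show ?thesis by blast
qed

text \<open>The three kinds of moments in \<open>Pproj\<close> are \<open>mom\<close> at the three
  kinds of index; for the energy, \<open>q0\<close> cancels against the weight in
  \<open>\<psi>\<close>. The rest is regrouping by invariants.\<close>

lemma Pproj_eq: "Pproj \<beta> f q = (\<Sum>k\<in>UNIV. coef f k * complex_of_real (\<phi> k q))"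
proof -
  have nz: "q0 q \<noteq> 0" for q using q0_pos[of q] by simp
  have 0: "(\<integral>p. f p * complex_of_real (sqrt (J p)) \<partial>lborel) = mom f (Inl True)"
    by (simp add: mom_def \<psi>_def \<phi>_def cinv_def nz)
  have 1: "(\<integral>p. f p * complex_of_real (sqrt (J p)) / complex_of_real (q0 p) \<partial>lborel) = mom f (Inl False)"
    by (simp add: mom_def \<psi>_def \<phi>_def cinv_def)
  have 2: "(\<integral>p. complex_of_real (p $ i) * (f p * complex_of_real (sqrt (J p))) / complex_of_real (q0 p) \<partial>lborel) = mom f (Inr i)" for i
    by (simp add: mom_def \<psi>_def \<phi>_def cinv_def mult_ac)
  show ?thesis
    unfolding Pproj_def Let_def 0 1 2 sum_bool_plus
    by (simp add: coef_def \<phi>_def cinv_def sum_distrib_left sum_distrib_right diff_divide_distrib algebra_simps)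
qed

text \<open>The multiplication part is controlled by \<open>1 / q0 \<le> 1\<close> and
  \<open>\<bar>\<zeta> \<bullet> q\<bar> \<le> norm \<zeta> * q0 q\<close>. Every invariant is at
  most \<open>q0\<close>, so the energy profile \<open>\<phi> (Inl True)\<close> dominates all
  functions that span the range of the projection.\<close>

lemma dominated_operator_Bhat: "\<exists>K. dominated_operator (Bhat \<beta> \<zeta>) (1 + norm \<zeta>) (\<lambda>q. K * \<phi> (Inl True) q)"
proof -
  obtain K where K: "K \<ge> 0" "\<And>f k. f \<in> L2 \<Longrightarrow> cmod (coef f k) \<le> K * L2norm f" using coef_bound by blast
  define K' where "K' = real CARD(bool + 3) * K"
  have \<phi>0: "0 \<le> \<phi> (Inl True) q" for q
    using q0_pos[of q] J_nonneg[of q] by (simp add: \<phi>_def cinv_def)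
  have P_le: "cmod (Pproj \<beta> f q) \<le> L2norm f * (K' * \<phi> (Inl True) q)" if f: "f \<in> L2" for f q
  proof -
    have "cmod (Pproj \<beta> f q) \<le> (\<Sum>k\<in>UNIV. cmod (coef f k * complex_of_real (\<phi> k q)))"
      unfolding Pproj_eq by (rule norm_sum)
    also have "\<dots> \<le> (\<Sum>k\<in>(UNIV :: (bool + 3) set). (K * L2norm f) * \<phi> (Inl True) q)"
    proof (intro sum_mono)
      fix k
      have "\<bar>\<phi> k q\<bar> \<le> \<phi> (Inl True) q"
        using mult_right_mono[OF cinv_le[of k q], of "sqrt (J q)"] J_nonneg[of q]
        by (simp add: \<phi>_def cinv_def[of "Inl True"] abs_mult)
      then show "cmod (coef f k * complex_of_real (\<phi> k q)) \<le> (K * L2norm f) * \<phi> (Inl True) q"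
        unfolding norm_mult norm_of_real using K f by (intro mult_mono) auto
    qed
    also have "\<dots> = L2norm f * (K' * \<phi> (Inl True) q)" by (simp add: K'_def)
    finally show ?thesis .
  qed
  have bound: "cmod (Bhat \<beta> \<zeta> f q) \<le> (1 + norm \<zeta>) * cmod (f q) + L2norm f * (K' * \<phi> (Inl True) q)"
    if f: "f \<in> L2" for f q
  proof -
    have div: "x / q0 q \<le> x" if "x \<ge> 0" for x
      using mult_left_mono[OF q0_ge_1[of q] that] q0_pos[of q] by (simp add: divide_le_eq)
    have "\<bar>\<zeta> \<bullet> q\<bar> \<le> norm \<zeta> * q0 q"
      using Cauchy_Schwarz_ineq2[of \<zeta> q] mult_left_mono[OF norm_le_q0[of q], of "norm \<zeta>"] by simp
    then have zq: "\<bar>(\<zeta> \<bullet> q) / q0 q\<bar> \<le> norm \<zeta>"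
      using q0_pos[of q] by (simp add: divide_le_eq)
    have "cmod (Bhat \<beta> \<zeta> f q) \<le> cmod ((Pproj \<beta> f q - f q) / complex_of_real (q0 q)) +
        cmod (\<i> * complex_of_real ((\<zeta> \<bullet> q) / q0 q) * f q)"
      unfolding Bhat_def Llin_def by (rule norm_triangle_ineq4)
    also have "cmod ((Pproj \<beta> f q - f q) / complex_of_real (q0 q)) \<le> cmod (Pproj \<beta> f q - f q)"
      using div[of "cmod (Pproj \<beta> f q - f q)"] q0_pos[of q] by (simp add: norm_divide)
    also have "cmod (Pproj \<beta> f q - f q) \<le> L2norm f * (K' * \<phi> (Inl True) q) + cmod (f q)"
      using norm_triangle_ineq4[of "Pproj \<beta> f q" "f q"] P_le[OF f, of q] by linarith
    also have "cmod (\<i> * complex_of_real ((\<zeta> \<bullet> q) / q0 q) * f q) \<le> norm \<zeta> * cmod (f q)"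
      unfolding norm_mult norm_of_real norm_ii mult_1 by (intro mult_right_mono zq) auto
    finally show ?thesis by (simp add: algebra_simps)
  qed
  have "dominated_operator (Bhat \<beta> \<zeta>) (1 + norm \<zeta>) (\<lambda>q. K' * \<phi> (Inl True) q)"
    unfolding dominated_operator_def
  proof (intro conjI ballI allI)
    fix f assume f: "f \<in> L2"
    show "Bhat \<beta> \<zeta> f \<in> L2"
    proof (rule L2_dominated(1))
      show "Bhat \<beta> \<zeta> f \<in> borel_measurable borel"
        unfolding Bhat_def[abs_def] Llin_def Pproj_eq using L2_measurable[OF f] by measurable
      let ?g = "\<lambda>q. complex_of_real (1 + norm \<zeta>) * complex_of_real (cmod (f q)) +
          complex_of_real (L2norm f * K') * complex_of_real (\<phi> (Inl True) q)"
      show "?g \<in> L2" by (intro L2_add L2_mult L2_cmod f \<phi>_L2)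
      show "cmod (Bhat \<beta> \<zeta> f q) \<le> cmod (?g q)" for q
      proof -
        have "cmod (Bhat \<beta> \<zeta> f q) \<le> (1 + norm \<zeta>) * cmod (f q) + L2norm f * (K' * \<phi> (Inl True) q)"
          by (rule bound[OF f])
        also have "\<dots> \<le> cmod (complex_of_real ((1 + norm \<zeta>) * cmod (f q) + L2norm f * (K' * \<phi> (Inl True) q)))"
          unfolding norm_of_real by simp
        also have "complex_of_real ((1 + norm \<zeta>) * cmod (f q) + L2norm f * (K' * \<phi> (Inl True) q)) = ?g q"
          by (simp add: mult.assoc)
        finally show ?thesis .
      qed
    qed
  next
    fix f g b c assume f: "f \<in> L2" and g: "g \<in> L2"
    have "Pproj \<beta> (\<lambda>q. b * f q + c * g q) q = b * Pproj \<beta> f q + c * Pproj \<beta> g q" for q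
      unfolding Pproj_eq coef_lincomb[OF f g]
      by (simp add: sum_distrib_left sum.distrib algebra_simps)
    then show "Bhat \<beta> \<zeta> (\<lambda>q. b * f q + c * g q) = (\<lambda>q. b * Bhat \<beta> \<zeta> f q + c * Bhat \<beta> \<zeta> g q)"
      by (auto simp: Bhat_def Llin_def diff_divide_distrib add_divide_distrib algebra_simps)
  next
    show "(\<lambda>q. complex_of_real (K' * \<phi> (Inl True) q)) \<in> L2"
      unfolding of_real_mult by (intro L2_mult \<phi>_L2)
  qed (use bound \<phi>0 K in \<open>auto simp: K'_def\<close>)
  then show ?thesis by blast
qed

section \<open>Gram matrix and dissipativity\<close>

lemma gram_integrable: "integrable lborel (\<lambda>q. cinv k q * cinv l q / q0 q * J q)"
proof (rule integrable_J_dominated)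
  show "\<bar>cinv k q * cinv l q / q0 q\<bar> \<le> (q0 q)\<^sup>2" for q
  proof -
    have "\<bar>cinv k q * cinv l q\<bar> \<le> q0 q * q0 q"
      unfolding abs_mult using cinv_le q0_pos[of q] by (intro mult_mono) auto
    also have "\<dots> \<le> (q0 q)\<^sup>2 * q0 q" using q0_ge_1[of q] by (simp add: power2_eq_square)
    finally show ?thesis using q0_pos[of q] by (simp add: divide_le_eq)
  qed
qed measurable

lemma gram_simps:
  "gram (Inl True) (Inl True) = Psi \<beta>" "gram (Inl True) (Inl False) = 1" "gram (Inl False) (Inl True) = 1"
  "gram (Inl False) (Inl False) = alpha0 \<beta>"
  "gram (Inl b) (Inr i) = 0" "gram (Inr i) (Inl b) = 0"
  "gram (Inr i) (Inr j) = (if i = j then 1 / \<beta> else 0)"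
proof -
  have nz: "q0 q \<noteq> 0" for q using q0_pos[of q] by simp
  show "gram (Inl True) (Inl True) = Psi \<beta>" "gram (Inl True) (Inl False) = 1" "gram (Inl False) (Inl True) = 1"
    "gram (Inl False) (Inl False) = alpha0 \<beta>" "gram (Inl b) (Inr i) = 0" "gram (Inr i) (Inl b) = 0"
    using moment_0_0 moment_0_1 moment_1_1 moment_odd(1,2)[of i]
    by (cases b; simp add: gram_def cinv_def nz)+
  show "gram (Inr i) (Inr j) = (if i = j then 1 / \<beta> else 0)"
    using moment_coordinates[of i] moment_odd(3)[of i j] by (cases "i = j") (simp_all add: gram_def cinv_def)
qed

text \<open>The left side is the squared weighted norm of the projection of \<open>f\<close>, the
  right side its weighted product with \<open>f\<close>. For nonzero \<open>kappa0\<close> they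
  agree because the Gram matrix maps the coefficients back to the moments.\<close>

lemma coef_projection: "(\<Sum>k\<in>UNIV. \<Sum>l\<in>UNIV. (coef f k \<bullet> coef f l) * gram k l) = (\<Sum>k\<in>UNIV. coef f k \<bullet> mom f k)"
proof -
  define a where "a = mom f (Inl True)"
  define b where "b = mom f (Inl False)"
  define c where "c = coef f (Inl True)"
  define d where "d = coef f (Inl False)"
  have "(\<Sum>k\<in>UNIV. \<Sum>l\<in>UNIV. (coef f k \<bullet> coef f l) * gram k l) =
      (c \<bullet> c) * Psi \<beta> + 2 * (c \<bullet> d) + (d \<bullet> d) * alpha0 \<beta> + (\<Sum>i\<in>UNIV. coef f (Inr i) \<bullet> coef f (Inr i) / \<beta>)"
    unfolding sum_bool_plus gram_simps
    by (simp add: c_def d_def inner_commute if_distrib sum.distrib cong: if_cong)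
  also have "(\<Sum>i\<in>UNIV. coef f (Inr i) \<bullet> coef f (Inr i) / \<beta>) = (\<Sum>i\<in>UNIV. coef f (Inr i) \<bullet> mom f (Inr i))"
    using \<beta> by (intro sum.cong refl) (simp add: coef_def inner_complex_def field_simps)
  also have "(c \<bullet> c) * Psi \<beta> + 2 * (c \<bullet> d) + (d \<bullet> d) * alpha0 \<beta> = c \<bullet> a + d \<bullet> b"
  proof (cases "kappa0 \<beta> = 0")
    case True \<comment> \<open>division by zero makes \<open>c\<close> and \<open>d\<close> vanish\<close>
    then show ?thesis by (simp add: c_def d_def coef_def)
  next
    case False
    have \<kappa>: "kappa0 \<beta> = alpha0 \<beta> * Psi \<beta> - 1"
      by (simp add: kappa0_def Psi_def alpha0_def power2_eq_square algebra_simps)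
    define r where "r = 1 / kappa0 \<beta>"
    have r: "r * (alpha0 \<beta> * Psi \<beta> - 1) = 1" using False by (simp add: r_def \<kappa>)
    have cd: "c = r *\<^sub>R (alpha0 \<beta> *\<^sub>R a - b)" "d = r *\<^sub>R (Psi \<beta> *\<^sub>R b - a)"
      unfolding c_def d_def a_def b_def coef_def r_def by (simp_all add: scaleR_conv_of_real)
    \<comment> \<open>The Gram block multiplied by its adjugate is its determinant times the
      identity, and \<open>r\<close> cancels the determinant.\<close>
    have "Psi \<beta> *\<^sub>R c + d = (r * (alpha0 \<beta> * Psi \<beta> - 1)) *\<^sub>R a" "c + alpha0 \<beta> *\<^sub>R d = (r * (alpha0 \<beta> * Psi \<beta> - 1)) *\<^sub>R b"
      unfolding cd by (simp_all add: algebra_simps)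
    then have a: "a = Psi \<beta> *\<^sub>R c + d" and b: "b = c + alpha0 \<beta> *\<^sub>R d" unfolding r by simp_all
    show ?thesis unfolding a b by (simp add: inner_add_right inner_commute algebra_simps)
  qed
  finally show ?thesis by (simp add: sum_bool_plus a_def b_def c_def d_def)
qed

text \<open>\<open>Pproj \<beta>\<close> is the orthogonal projection onto the collision invariants in the space weighted
  by \<open>1 / q0\<close>, the weight produced by the factor \<open>1 / q0\<close> in \<open>Llin\<close>.\<close>

lemma Bhat_dissipative:
  assumes f: "f \<in> L2"
  shows "L2inner f (Bhat \<beta> \<zeta> f) \<le> 0"
proof -
  define u where "u q = Pproj \<beta> f q" for q
  \<comment> \<open>\<open>v\<close> and \<open>g\<close> are the projection and \<open>f\<close>
    divided by \<open>q0\<close>; plain products with them are products in the weighted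
    space.\<close>
  define v where "v q = (\<Sum>k\<in>UNIV. coef f k * complex_of_real (\<psi> k q))" for q
  define g where "g q = f q / complex_of_real (q0 q)" for q
  have [measurable]: "f \<in> borel_measurable borel" by (rule L2_measurable[OF f])
  have u: "u \<in> L2" unfolding u_def Pproj_eq by (intro L2_sum L2_mult \<phi>_L2) auto
  have v: "v \<in> L2" unfolding v_def by (intro L2_sum L2_mult \<psi>_L2) auto
  have uv: "v q = u q / complex_of_real (q0 q)" for q
    by (simp add: v_def u_def Pproj_eq \<psi>_def sum_divide_distrib)
  have g: "g \<in> L2"
  proof (rule L2_dominated(1)[OF _ f])
    show "cmod (g q) \<le> cmod (f q)" for q
      using q0_pos[of q] mult_left_mono[OF q0_ge_1[of q], of "cmod (f q)"]
      by (simp add: g_def norm_divide divide_le_eq)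
  qed (simp add: g_def[abs_def])
  have fv: "L2inner f v = (\<Sum>k\<in>UNIV. coef f k \<bullet> mom f k)"
  proof -
    have "L2inner f v = (\<integral>q. (\<Sum>k\<in>UNIV. coef f k \<bullet> (f q * complex_of_real (\<psi> k q))) \<partial>lborel)"
      by (simp add: L2inner_def v_def inner_sum_right inner_mult_of_real)
    also have "\<dots> = (\<Sum>k\<in>UNIV. \<integral>q. coef f k \<bullet> (f q * complex_of_real (\<psi> k q)) \<partial>lborel)"
      by (intro Bochner_Integration.integral_sum integrable_inner_right mom_integrable f)
    also have "\<dots> = (\<Sum>k\<in>UNIV. coef f k \<bullet> mom f k)"
      unfolding mom_def by (intro sum.cong refl integral_inner_right mom_integrable f)
    finally show ?thesis .
  qed
  have "L2inner u v = (\<integral>q. (\<Sum>k\<in>UNIV. \<Sum>l\<in>UNIV. (coef f k \<bullet> coef f l) * (cinv k q * cinv l q / q0 q * J q)) \<partial>lborel)"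
    unfolding L2inner_def
  proof (intro Bochner_Integration.integral_cong refl)
    fix q
    have "(x * complex_of_real (\<phi> k q)) \<bullet> (y * complex_of_real (\<psi> l q)) =
        (x \<bullet> y) * (cinv k q * cinv l q / q0 q * J q)" for x y k l
    proof -
      have "sqrt (J q) * sqrt (J q) = J q" using J_nonneg[of q] by simp
      then have "\<phi> k q * \<psi> l q = cinv k q * cinv l q / q0 q * J q"
        by (simp add: \<phi>_def \<psi>_def mult_ac)
      moreover have "(x * complex_of_real (\<phi> k q)) \<bullet> (y * complex_of_real (\<psi> l q)) = (x \<bullet> y) * (\<phi> k q * \<psi> l q)"
        by (simp add: inner_complex_def algebra_simps)
      ultimately show ?thesis by simp
    qed
    then show "u q \<bullet> v q = (\<Sum>k\<in>UNIV. \<Sum>l\<in>UNIV. (coef f k \<bullet> coef f l) * (cinv k q * cinv l q / q0 q * J q))"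
      unfolding u_def v_def Pproj_eq inner_sum_left unfolding inner_sum_right by simp
  qed
  also have "\<dots> = (\<Sum>k\<in>UNIV. \<Sum>l\<in>UNIV. (coef f k \<bullet> coef f l) * gram k l)"
  proof -
    let ?h = "\<lambda>k l q. (coef f k \<bullet> coef f l) * (cinv k q * cinv l q / q0 q * J q)"
    have h: "integrable lborel (?h k l)" for k l by (intro integrable_mult_right gram_integrable)
    have "(\<integral>q. (\<Sum>k\<in>UNIV. \<Sum>l\<in>UNIV. ?h k l q) \<partial>lborel) = (\<Sum>k\<in>UNIV. \<integral>q. (\<Sum>l\<in>UNIV. ?h k l q) \<partial>lborel)"
      by (intro Bochner_Integration.integral_sum Bochner_Integration.integrable_sum h)
    also have "\<dots> = (\<Sum>k\<in>UNIV. \<Sum>l\<in>UNIV. \<integral>q. ?h k l q \<partial>lborel)"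
      by (intro sum.cong refl Bochner_Integration.integral_sum h)
    also have "\<dots> = (\<Sum>k\<in>UNIV. \<Sum>l\<in>UNIV. (coef f k \<bullet> coef f l) * gram k l)"
      unfolding gram_def by (intro sum.cong refl integral_mult_right_zero)
    finally show ?thesis .
  qed
  also have "\<dots> = L2inner f v" unfolding coef_projection fv ..
  finally have uv_eq: "L2inner u v = L2inner f v" .
  \<comment> \<open>The integrand is the squared modulus of \<open>f - u\<close> divided by
    \<open>q0\<close>. By \<open>uv_eq\<close> the last two of its three terms combine to minus one
    copy of \<open>L2inner f v\<close>.\<close>
  have "0 \<le> (\<integral>q. (f q \<bullet> g q - 2 * (f q \<bullet> v q)) + u q \<bullet> v q \<partial>lborel)"
  proof (intro integral_nonneg_AE AE_I2)
    fix q
    have "(f q \<bullet> g q - 2 * (f q \<bullet> v q)) + u q \<bullet> v q = (norm (f q - u q))\<^sup>2 / q0 q"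
      unfolding power2_norm_eq_inner
      by (simp add: g_def uv inner_complex_def diff_divide_distrib add_divide_distrib algebra_simps)
    then show "0 \<le> (f q \<bullet> g q - 2 * (f q \<bullet> v q)) + u q \<bullet> v q" using q0_pos[of q] by simp
  qed
  also have "\<dots> = L2inner f g - L2inner f v"
    using L2inner_integrable[OF f g] L2inner_integrable[OF f v] L2inner_integrable[OF u v] uv_eq
    by (simp add: L2inner_def)
  finally have "L2inner f v \<le> L2inner f g" by simp
  moreover have "L2inner f (Bhat \<beta> \<zeta> f) = (\<integral>q. f q \<bullet> v q - f q \<bullet> g q \<partial>lborel)"
    unfolding L2inner_def
  proof (intro Bochner_Integration.integral_cong refl)
    fix q
    \<comment> \<open>A purely imaginary factor turns \<open>f q\<close> by a right angle in the
      plane, so the transport term drops out at every point.\<close>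
    have "f q \<bullet> (\<i> * complex_of_real r * f q) = 0" for r
      by (simp add: inner_complex_def)
    moreover have "Bhat \<beta> \<zeta> f q = v q - g q - \<i> * complex_of_real ((\<zeta> \<bullet> q) / q0 q) * f q"
      by (simp add: Bhat_def Llin_def uv u_def g_def diff_divide_distrib)
    ultimately show "f q \<bullet> Bhat \<beta> \<zeta> f q = f q \<bullet> v q - f q \<bullet> g q"
      by (simp only: inner_diff_right diff_zero)
  qed
  ultimately show ?thesis
    using L2inner_integrable[OF f g] L2inner_integrable[OF f v] by (simp add: L2inner_def)
qed

end

theorem theorem5p1:
  fixes \<beta>0 :: real and \<zeta> :: "real^3"
  assumes "\<beta>0 > 0"
  shows "(\<exists>T. contraction_semigroup T \<and> has_generator T L2 (Bhat \<beta>0 \<zeta>)) \<and>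
         (\<forall>T. C0_semigroup T \<and> has_generator T L2 (Bhat \<beta>0 \<zeta>) \<longrightarrow>
            (\<forall>f\<in>L2. \<forall>t\<ge>0. L2norm (T t f) \<le> L2norm f))"
proof -
  have contraction: "L2norm (T t f) \<le> L2norm f"
    if "C0_semigroup T" "has_generator T L2 (Bhat \<beta>0 \<zeta>)" "f \<in> L2" "t \<ge> 0" for T f t
    using dissipative_imp_contraction[OF that(1,2) Bhat_dissipative[OF assms] that(3,4)] .
  obtain a G where dom: "dominated_operator (Bhat \<beta>0 \<zeta>) a G"
    using dominated_operator_Bhat[OF assms] by blast
  \<comment> \<open>The bound \<open>expA_norm\<close> grows with \<open>t\<close>; contractivity of
    the series comes from the estimate for arbitrary semigroups.\<close>
  have "contraction_semigroup (expA (Bhat \<beta>0 \<zeta>))"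
    unfolding contraction_semigroup_def
    using C0_semigroup_expA[OF dom] contraction[OF C0_semigroup_expA[OF dom] has_generator_expA[OF dom]] by blast
  then show ?thesis
    using has_generator_expA[OF dom] contraction by blast
qed

end
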